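(* Let $f:\mathbb{D}\to\widehat{\mathbb{C}}$ be spherically convex. Then $$A_s f(r\mathbb{D})\le A_s(r\mathbb{D})\quad\text{for every } 0<r<1.$$ Moreover, equality holds for some $0<r<1$ if and only if $f$ is a spherical isometry.
   Context: $\mathbb{D}=\{z\in\mathbb{C}:|z|<1\}$, $\widehat{\mathbb{C}}=\mathbb{C}\cup\{\infty\}$ is the Riemann sphere with the spherical metric $\frac{|dz|}{1+|z|^2}$ (Gaussian curvature $+4$). For two non-antipodal points $a,b\in\widehat{\mathbb{C}}$, the spherical geodesic joining them is the smaller arc of the great circle through $a$ and $b$. A domain $\Omega\subset\widehat{\mathbb{C}}$ is spherically convex if for any two points $a,b\in\Omega$ that are not antipodal the spherical geodesic joining $a$ and $b$ lies in $\Omega$. A meromorphic univalent (injective) map $f:\mathbb{D}\to\widehat{\mathbb{C}}$ is called spherically convex if $f(\mathbb{D})$ is a spherically convex domain. The group of (meromorphic) spherical isometries is $$\mathrm{Rot}(\widehat{\mathbb{C}})=\left\{e^{i\theta}\frac{z-a}{1+z\overline{a}}: a\in\mathbb{C},\theta\in\mathbb{R}\right\}\cup\left\{\frac{e^{i\theta}}{z}:\theta\in\mathbb{R}\right\};$$ "$f$ is a spherical isometry" means that $f$ is the restriction to $\mathbb{D}$ of an element of $\mathrm{Rot}(\widehat{\mathbb{C}})$. The spherical derivative is $f^{\sharp}(z)=\frac{|f'(z)|}{1+|f(z)|^2}$ (at a pole of $f$ defined by continuous extension). With $dA$ Lebesgue area measure and $r\mathbb{D}=\{|z|<r\}$, $$A_s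 f(r\mathbb{D})=\iint_{r\mathbb{D}}f^{\sharp}(z)^2\,dA(z),\qquad A_s(r\mathbb{D})=\iint_{r\mathbb{D}}\frac{dA(z)}{(1+|z|^2)^2}=\frac{\pi r^2}{1+r^2}.$$ *)

theory Defs
  imports "HOL-Complex_Analysis.Complex_Analysis"
begin

text \<open>
  The Riemann sphere is \<open>complex option\<close>, with \<open>None\<close> the point at infinity. Its topology
  is the one-point compactification of the plane.
\<close>

type_synonym riemann_sphere = "complex option"

abbreviation sphere_topology :: "riemann_sphere topology"
  where "sphere_topology \<equiv> Alexandroff_compactification euclidean"

text \<open>
  Inverse stereographic projection onto the unit sphere of \<open>\<complex> \<times> \<real>\<close>. It pulls back the round
  metric of the unit sphere to \<open>2 |dz| / (1 + |z|\<^sup>2)\<close>, twice the metric of curvature \<open>4\<close>, so great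
  circles, antipodal points and the comparison of arc lengths are the same for both.
\<close>

definition stereo :: "riemann_sphere \<Rightarrow> complex \<times> real"
  where "stereo p = (case p of
      None \<Rightarrow> (0, 1)
    | Some z \<Rightarrow> ((2 / (1 + (cmod z)\<^sup>2)) *\<^sub>R z, ((cmod z)\<^sup>2 - 1) / (1 + (cmod z)\<^sup>2)))"

definition antipodal :: "riemann_sphere \<Rightarrow> riemann_sphere \<Rightarrow> bool"
  where "antipodal a b \<longleftrightarrow> stereo b = - stereo a"

text \<open>For orthonormal \<open>u\<close>, \<open>v\<close> this is the unit speed great circle starting at \<open>u\<close> in direction \<open>v\<close>.\<close>

definition great_circle :: "complex \<times> real \<Rightarrow> complex \<times> real \<Rightarrow> real \<Rightarrow> complex \<times> real"
  where "great_circle u v t = cos t *\<^sub>R u + sin t *\<^sub>R v"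

text \<open>
  The smaller arc is the one of length \<open>l < pi\<close> on the unit sphere. For \<open>a = b\<close> this forces \<open>l = 0\<close>,
  giving \<open>{a}\<close>; for antipodal points, where the smaller arc is undefined, the set is empty.
\<close>

definition spherical_geodesic :: "riemann_sphere \<Rightarrow> riemann_sphere \<Rightarrow> riemann_sphere set"
  where "spherical_geodesic a b = {c. \<exists>u v l.
      norm u = 1 \<and> norm v = 1 \<and> u \<bullet> v = 0 \<and> 0 \<le> l \<and> l < pi \<and>
      great_circle u v 0 = stereo a \<and> great_circle u v l = stereo b \<and>
      stereo c \<in> great_circle u v ` {0..l}}"

definition sphere_domain :: "riemann_sphere set \<Rightarrow> bool"
  where "sphere_domain \<Omega> \<longleftrightarrow>
    \<Omega> \<noteq> {} \<and> openin sphere_topology \<Omega> \<and> connectedin sphere_topology \<Omega>"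

definition spherically_convex :: "riemann_sphere set \<Rightarrow> bool"
  where "spherically_convex \<Omega> \<longleftrightarrow> sphere_domain \<Omega> \<and>
    (\<forall>a\<in>\<Omega>. \<forall>b\<in>\<Omega>. \<not> antipodal a b \<longrightarrow> spherical_geodesic a b \<subseteq> \<Omega>)"

text \<open>
  The finite part takes the value \<open>0\<close> at infinity, which is the convention of
  \<open>nicely_meromorphic_on\<close> for values at poles.
\<close>

definition finite_part :: "(complex \<Rightarrow> riemann_sphere) \<Rightarrow> complex \<Rightarrow> complex"
  where "finite_part f z = (case f z of None \<Rightarrow> 0 | Some w \<Rightarrow> w)"

definition sphere_meromorphic_on :: "(complex \<Rightarrow> riemann_sphere) \<Rightarrow> complex set \<Rightarrow> bool"
  where "sphere_meromorphic_on f A \<longleftrightarrow>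
    finite_part f nicely_meromorphic_on A \<and> (\<forall>z\<in>A. f z = None \<longleftrightarrow> is_pole (finite_part f) z)"

definition spherically_convex_map :: "(complex \<Rightarrow> riemann_sphere) \<Rightarrow> bool"
  where "spherically_convex_map f \<longleftrightarrow>
    sphere_meromorphic_on f (ball 0 1) \<and> inj_on f (ball 0 1) \<and> spherically_convex (f ` ball 0 1)"

text \<open>The Moebius transformation \<open>z \<mapsto> (a z + b) / (c z + d)\<close> of the Riemann sphere.\<close>

definition moebius :: "complex \<Rightarrow> complex \<Rightarrow> complex \<Rightarrow> complex \<Rightarrow> riemann_sphere \<Rightarrow> riemann_sphere"
  where "moebius a b c d p = (case p of
      None \<Rightarrow> if c = 0 then None else Some (a / c)
    | Some z \<Rightarrow> if c * z + d = 0 then None else Some ((a * z + b) / (c * z + d)))"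

definition Rot :: "(riemann_sphere \<Rightarrow> riemann_sphere) set"
  where "Rot = {moebius (cis \<theta>) (- (cis \<theta> * a)) (cnj a) 1 | a \<theta>. True} \<union>
               {moebius 0 (cis \<theta>) 1 0 | \<theta>. True}"

definition spherical_isometry :: "(complex \<Rightarrow> riemann_sphere) \<Rightarrow> bool"
  where "spherical_isometry f \<longleftrightarrow> (\<exists>\<rho>\<in>Rot. \<forall>z\<in>ball 0 1. f z = \<rho> (Some z))"

definition spherical_deriv :: "(complex \<Rightarrow> riemann_sphere) \<Rightarrow> complex \<Rightarrow> real"
  where "spherical_deriv f z =
    (let g = finite_part f; q = (\<lambda>w. cmod (deriv g w) / (1 + (cmod (g w))\<^sup>2))
     in if f z = None then Lim (at z) q else q z)"

text \<open>Areas are extended nonnegative Lebesgue integrals, so no integrability has to be assumed.\<close>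

definition image_area :: "(complex \<Rightarrow> riemann_sphere) \<Rightarrow> real \<Rightarrow> ennreal"
  where "image_area f r = (\<integral>\<^sup>+z\<in>ball 0 r. ennreal ((spherical_deriv f z)\<^sup>2) \<partial>lborel)"

definition disc_area :: "real \<Rightarrow> ennreal"
  where "disc_area r = (\<integral>\<^sup>+z\<in>ball (0::complex) r. ennreal (1 / (1 + (cmod z)\<^sup>2)\<^sup>2) \<partial>lborel)"

end

theory Submission
  imports Defs
begin

text \<open>
  The area inequality follows from two facts: a spherically convex domain that is the image of a disc
  lies in a hemisphere, and the Schwarz-Pick lemma bounds the spherical area of what a function into a
  hemisphere covers.

  A spherically convex domain \<open>\<Omega>\<close> that contains two antipodal points is the whole sphere, and the
  whole sphere is not an injective image of the disc, by Liouville's theorem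
  (\<open>injective_sphere_meromorphic\<close>). If \<open>\<Omega>\<close> contains no antipodal points, the cone over it in
  three-space is convex and does not contain its apex. A separating hyperplane through the apex
  shows that \<open>\<Omega>\<close> lies in an open hemisphere (\<open>spherically_convex_subset_hemisphere\<close>).

  Rotating the sphere changes neither spherical derivatives nor areas, so \<open>f\<close> may be replaced by
  an injective holomorphic function \<open>h\<close> from the unit disc into itself. With \<open>a = h 0\<close>, the
  Schwarz-Pick lemma says that \<open>h\<close> maps the disc of radius \<open>r\<close> into the hyperbolic disc
  \<open>\<bar>w - a\<bar> < r \<bar>1 - cnj a w\<bar>\<close>. For \<open>a \<noteq> 0\<close> this is contained, with a gap, in a spherical disc
  congruent to \<open>\<bar>w\<bar> < r\<close>, by an explicit identity (\<open>spherical_disc_contains_hyperbolic_disc\<close>).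
  For \<open>a = 0\<close> there is a gap by the strict Schwarz lemma, unless \<open>h\<close> is a rotation about the origin.
  As \<open>h\<close> is injective, the area in question is that of the image, and comparing areas of discs gives
  a strict inequality in every case except that \<open>h\<close>, and with it \<open>f\<close>, is an isometry. Isometries
  clearly give equality for every radius.
\<close>

section \<open>Spherical area of injective holomorphic images\<close>

lemma one_plus_cmod_sq_pos: "0 < 1 + (cmod z)\<^sup>2"
  by (simp add: add_pos_nonneg)

text \<open>
  The change of variables theorem lives on \<^typ>\<open>real^2\<close>; these two isometries carry it over to
  \<^typ>\<open>complex\<close>.
\<close>

definition cplx :: "real^2 \<Rightarrow> complex" where "cplx v = Complex (v$1) (v$2)"
definition vect :: "complex \<Rightarrow> real^2" where "vect z = vector [Re z, Im z]"

lemma cplx_vect [simp]: "cplx (vect z) = z"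
  by (simp add: cplx_def vect_def)
lemma vect_cplx [simp]: "vect (cplx v) = v"
  by (simp add: cplx_def vect_def vec_eq_iff forall_2)
lemma linear_cplx: "linear cplx"
  by (rule linearI) (simp_all add: cplx_def complex_eq_iff)
lemma linear_vect: "linear vect"
  by (rule linearI) (simp_all add: vect_def vec_eq_iff forall_2)

lemma cplx_measurable [measurable]: "cplx \<in> borel_measurable borel"
  by (intro borel_measurable_continuous_onI linear_continuous_on linear_conv_bounded_linear[THEN iffD1] linear_cplx)

lemma Basis_vec2: "(Basis :: (real^2) set) = {axis 1 1, axis 2 1}"
  by (auto simp: Basis_vec_def UNIV_2)

lemma lborel_complex_eq_distr: "(lborel :: complex measure) = distr lborel borel cplx"
proof (rule lborel_eqI)
  fix l u :: complex assume le: "\<And>b. b \<in> Basis \<Longrightarrow> l \<bullet> b \<le> u \<bullet> b"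
  have "Re l \<le> Re u" "Im l \<le> Im u" using le[of 1] le[of \<i>] by (auto simp: Basis_complex_def)
  moreover have "cplx -` box l u = box (vect l) (vect u)"
    by (auto simp: box_def Basis_vec2 Basis_complex_def inner_axis cplx_def vect_def)
  moreover have "axis 1 1 \<noteq> (axis 2 1 :: real^2)" by (simp add: axis_eq_axis)
  ultimately show "emeasure (distr lborel borel cplx) (box l u) = ennreal (\<Prod>b\<in>Basis. (u - l) \<bullet> b)"
    by (subst emeasure_distr)
      (auto simp: emeasure_lborel_box_eq Basis_vec2 Basis_complex_def inner_axis vect_def)
qed auto

text \<open>
  Viewed on the real plane, the derivative of \<open>k\<close> is multiplication by \<open>k'(z)\<close>, whose determinant is
  \<open>\<bar>k'(z)\<bar>\<^sup>2\<close>. Hence this is the change of variables formula; boundedness of the image makes the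
  continuous weight \<open>F\<close> integrable over it, which is what that formula asks for.
\<close>

lemma area_image_holomorphic:
  fixes k :: "complex \<Rightarrow> complex" and F :: "complex \<Rightarrow> real"
  assumes U: "open U" and holo: "k holomorphic_on U" and inj: "inj_on k U"
    and bdd: "bounded (k ` U)" and F: "continuous_on UNIV F" and F0: "\<And>w. 0 \<le> F w"
  shows "(\<integral>\<^sup>+z\<in>U. ennreal ((cmod (deriv k z))\<^sup>2 * F (k z)) \<partial>lborel)
       = (\<integral>\<^sup>+w\<in>k ` U. ennreal (F w) \<partial>lborel)"
proof -
  define S where "S = vect ` U"
  define g where "g = vect \<circ> k \<circ> cplx"
  define g' where "g' = (\<lambda>x. vect \<circ> (*) (deriv k (cplx x)) \<circ> cplx)"
  have contc: "continuous_on A cplx" for A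
    by (intro linear_continuous_on linear_conv_bounded_linear[THEN iffD1] linear_cplx)
  have S: "S = cplx -` U" unfolding S_def by (auto simp: image_iff) (metis vect_cplx)
  have oS: "open S" unfolding S using U contc[of UNIV] by (simp add: continuous_on_open_vimage)
  have oV: "open (k ` U)" using open_mapping_thm3[OF holo U inj] .
  have gS: "g ` S = cplx -` (k ` U)" unfolding S_def g_def by (auto simp: image_iff) (metis vect_cplx)
  have ogS: "open (g ` S)" unfolding gS using oV contc[of UNIV] by (simp add: continuous_on_open_vimage)
  have gS2: "g ` S = vect ` (k ` U)" unfolding S_def g_def by (auto simp: image_iff)
  have bgS: "bounded (g ` S)" unfolding gS2 
    using bdd linear_vect by (simp add: bounded_linear_image linear_conv_bounded_linear)
  have der: "(g has_derivative g' x) (at x within S)" if "x \<in> S" for x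
  proof -
    have "cplx x \<in> U" using that S by auto
    then have "(k has_derivative (*) (deriv k (cplx x))) (at (cplx x))"
      using holo U by (metis has_field_derivative_def holomorphic_derivI)
    moreover have "(cplx has_derivative cplx) (at x)" 
      by (intro linear_imp_has_derivative linear_cplx)
    ultimately have "(k \<circ> cplx has_derivative (*) (deriv k (cplx x)) \<circ> cplx) (at x)"
      by (intro diff_chain_at)
    then have "(vect \<circ> (k \<circ> cplx) has_derivative vect \<circ> ((*) (deriv k (cplx x)) \<circ> cplx)) (at x)"
      by (rule diff_chain_at) (rule linear_imp_has_derivative[OF linear_vect])
    then show ?thesis unfolding g_def g'_def by (simp add: o_assoc has_derivative_at_withinI)
  qed
  have det: "det (matrix (g' x)) = (cmod (deriv k (cplx x)))\<^sup>2" for x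
    by (simp add: det_2 matrix_def g'_def vect_def cplx_def axis_def cmod_power2 flip: power2_eq_square)
  have injg: "inj_on g S"
    using inj unfolding S_def g_def inj_on_def by (auto, metis cplx_vect)
  \<comment> \<open>The theorem is about vector valued integrands, so the weight is lifted to dimension one.\<close>
  define G where "G = (\<lambda>v. vec (F (cplx v)) :: real^1)"
  have contG: "continuous_on A G" for A
    unfolding G_def vec_def
    by (intro continuous_on_vec_lambda continuous_on_compose2[OF F contc]) auto
  \<comment> \<open>A box around the image: there the continuous weight is integrable.\<close>
  obtain a where "g ` S \<subseteq> cbox (-a) a" using bounded_subset_cbox_symmetric[OF bgS] by auto
  moreover have "G absolutely_integrable_on cbox (-a) a"
    by (rule absolutely_integrable_continuous[OF contG])
  ultimately have Gabs: "G absolutely_integrable_on g ` S"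
    using ogS by (metis borel_open lmeasurable_open set_integrable_subset sets_completionI_sets sets_lborel)
  have cv: "(\<lambda>x. \<bar>det (matrix (g' x))\<bar> *\<^sub>R G (g x)) absolutely_integrable_on S \<and>
        integral S (\<lambda>x. \<bar>det (matrix (g' x))\<bar> *\<^sub>R G (g x)) = integral (g ` S) G"
    using oS Gabs
    by (intro has_absolute_integral_change_of_variables[OF _ der injg, THEN iffD2]) auto
  define H where "H = (\<lambda>x. (cmod (deriv k (cplx x)))\<^sup>2 * F (k (cplx x)))"
  have GH: "(\<lambda>x. \<bar>det (matrix (g' x))\<bar> *\<^sub>R G (g x)) = (\<lambda>x. vec (H x))"
    by (auto simp: det G_def g_def H_def fun_eq_iff vec_eq_iff)
  have "H absolutely_integrable_on S" "(\<lambda>v. F (cplx v)) absolutely_integrable_on (g ` S)"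
    "integral S H = integral (g ` S) (\<lambda>v. F (cplx v))"
    using cv[unfolded GH] Gabs unfolding absolutely_integrable_on_1_iff integral_on_1_eq G_def
    by (auto simp: vec_eq_iff)
  then have "(H has_integral (integral (g ` S) (\<lambda>v. F (cplx v)))) S"
     "((\<lambda>v. F (cplx v)) has_integral (integral (g ` S) (\<lambda>v. F (cplx v)))) (g ` S)"
    by (auto simp: absolutely_integrable_on_def has_integral_iff)
  then have eq: "(\<integral>\<^sup>+x. ennreal (indicator S x * H x) \<partial>lborel) = (\<integral>\<^sup>+x. ennreal (indicator (g ` S) x * F (cplx x)) \<partial>lborel)"
    using F0 by (auto dest!: nn_integral_has_integral_lebesgue[rotated] simp: H_def)
  have m1: "(\<lambda>z. ennreal ((cmod (deriv k z))\<^sup>2 * F (k z)) * indicator U z) \<in> borel_measurable borel"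
  proof -
    have "continuous_on U (\<lambda>z. (cmod (deriv k z))\<^sup>2 * F (k z))"
    proof (rule continuous_on_mult)
      show "continuous_on U (\<lambda>z. (cmod (deriv k z))\<^sup>2)"
        by (intro continuous_on_power continuous_on_norm holomorphic_on_imp_continuous_on
            holomorphic_deriv[OF holo U])
      show "continuous_on U (\<lambda>z. F (k z))"
        by (rule continuous_on_compose2[OF F holomorphic_on_imp_continuous_on[OF holo]]) simp
    qed
    then have "(\<lambda>z. indicator U z *\<^sub>R ((cmod (deriv k z))\<^sup>2 * F (k z))) \<in> borel_measurable borel"
      using U by (intro borel_measurable_continuous_on_indicator) auto
    then have "(\<lambda>z. ennreal (indicator U z *\<^sub>R ((cmod (deriv k z))\<^sup>2 * F (k z)))) \<in> borel_measurable borel"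
      by (rule measurable_compose) measurable
    also have "(\<lambda>z. ennreal (indicator U z *\<^sub>R ((cmod (deriv k z))\<^sup>2 * F (k z))))
        = (\<lambda>z. ennreal ((cmod (deriv k z))\<^sup>2 * F (k z)) * indicator U z)"
      by (auto simp: indicator_def fun_eq_iff)
    finally show ?thesis .
  qed
  have m2: "(\<lambda>w. ennreal (F w) * indicator (k ` U) w) \<in> borel_measurable borel"
    using oV borel_measurable_continuous_onI[OF F]
    by (intro borel_measurable_times_ennreal borel_measurable_indicator measurable_compose[OF _ measurable_ennreal]) auto
  have "(\<integral>\<^sup>+z\<in>U. ennreal ((cmod (deriv k z))\<^sup>2 * F (k z)) \<partial>lborel)
      = (\<integral>\<^sup>+x. ennreal (indicator S x * H x) \<partial>lborel)"
    using m1 by (subst lborel_complex_eq_distr, subst nn_integral_distr)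
      (auto simp: S H_def indicator_def intro!: nn_integral_cong)
  also have "\<dots> = (\<integral>\<^sup>+x. ennreal (indicator (g ` S) x * F (cplx x)) \<partial>lborel)"
    by (rule eq)
  also have "\<dots> = (\<integral>\<^sup>+w\<in>k ` U. ennreal (F w) \<partial>lborel)"
    using m2 by (subst lborel_complex_eq_distr, subst nn_integral_distr)
      (auto simp: gS indicator_def intro!: nn_integral_cong)
  finally show ?thesis .
qed

text \<open>
  The annulus between the two circles contains a nonempty open set, so it carries positive area;
  finiteness of \<^term>\<open>disc_area s\<close> then turns this into a strict inequality.
\<close>

lemma disc_area_strict_mono:
  assumes "0 \<le> s" "s < r" 
  shows "disc_area s < disc_area r"
proof -
  let ?F = "\<lambda>z::complex. 1 / (1 + (cmod z)\<^sup>2)\<^sup>2"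
  have mF: "(\<lambda>z. ennreal (?F z)) \<in> borel_measurable borel" by measurable
  have fin: "disc_area s < \<infinity>"
  proof -
    have "disc_area s \<le> (\<integral>\<^sup>+z. indicator (ball (0::complex) s) z \<partial>lborel)"
      unfolding disc_area_def by (intro nn_integral_mono) (auto simp: indicator_def divide_le_eq_1)
    also have "\<dots> = emeasure lborel (ball (0::complex) s)" by simp
    also have "\<dots> < \<infinity>" using emeasure_bounded_finite[OF bounded_ball] .
    finally show ?thesis .
  qed
  let ?R = "ball (0::complex) r - ball 0 s"
  have "(\<integral>\<^sup>+z\<in>?R. ennreal (?F z) \<partial>lborel) \<noteq> 0"
  proof
    assume "(\<integral>\<^sup>+z\<in>?R. ennreal (?F z) \<partial>lborel) = 0"
    then have "AE z in lborel. ennreal (?F z) * indicator ?R z = 0"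
      by (subst (asm) nn_integral_0_iff_AE) (use mF in \<open>auto intro!: borel_measurable_times_ennreal borel_measurable_indicator\<close>)
    then have "AE z in lborel. z \<notin> ?R"
      proof eventually_elim
      case (elim z)
      then show ?case using one_plus_cmod_sq_pos[of z] by (simp add: indicator_def split: if_splits)
    qed
    then have "?R \<in> null_sets lborel" by (subst (asm) AE_iff_null_sets[symmetric]) auto
    then have neg: "negligible ?R" using negligible_iff_null_sets null_sets_completionI by blast
    have "ball 0 r - cball 0 s \<subseteq> ?R" by auto
    then have "negligible (ball (0::complex) r - cball 0 s)" using neg negligible_subset by blast
    moreover have "complex_of_real ((s+r)/2) \<in> ball 0 r - cball 0 s"
    proof -
      have "cmod (complex_of_real ((s+r)/2)) = (s+r)/2" using assms by (subst norm_of_real) simp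
      then show ?thesis using assms by simp
    qed
    ultimately show False by (metis open_Diff closed_cball empty_iff open_ball open_not_negligible)
  qed
  then have "disc_area s + 0 < disc_area s + (\<integral>\<^sup>+z\<in>?R. ennreal (?F z) \<partial>lborel)"
    using fin by (intro ennreal_add_left_cancel_less[THEN iffD2]) (auto simp: zero_less_iff_neq_zero)
  also have "\<dots> = disc_area r"
    unfolding disc_area_def using assms mF
    by (subst nn_integral_add[symmetric]) (auto intro!: nn_integral_cong simp: indicator_def)
  finally show ?thesis by simp
qed

text \<open>
  Injectivity is what makes this true: the left-hand side is then the spherical area of the image
  itself, without multiplicity.
\<close>

lemma area_image_le_disc_area:
  fixes k :: "complex \<Rightarrow> complex"
  assumes U: "open U" and holo: "k holomorphic_on U" and inj: "inj_on k U"
    and sub: "k ` U \<subseteq> ball 0 s" 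
  shows "(\<integral>\<^sup>+z\<in>U. ennreal ((cmod (deriv k z) / (1 + (cmod (k z))\<^sup>2))\<^sup>2) \<partial>lborel) \<le> disc_area s"
proof -
  let ?F = "\<lambda>z::complex. 1 / (1 + (cmod z)\<^sup>2)\<^sup>2"
  have nz: "1 + (cmod w)\<^sup>2 \<noteq> 0" for w using one_plus_cmod_sq_pos[of w] by simp
  have "(\<integral>\<^sup>+z\<in>U. ennreal ((cmod (deriv k z) / (1 + (cmod (k z))\<^sup>2))\<^sup>2) \<partial>lborel)
     = (\<integral>\<^sup>+z\<in>U. ennreal ((cmod (deriv k z))\<^sup>2 * ?F (k z)) \<partial>lborel)"
    by (simp add: power_divide)
  also have "\<dots> = (\<integral>\<^sup>+w\<in>k ` U. ennreal (?F w) \<partial>lborel)"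
  proof (rule area_image_holomorphic[OF U holo inj])
    show "bounded (k ` U)" using sub bounded_subset[OF bounded_ball] by blast
    show "continuous_on UNIV ?F" using nz by (intro continuous_intros) auto
  qed simp
  also have "\<dots> \<le> disc_area s" unfolding disc_area_def using sub
    by (intro nn_integral_mono) (auto simp: indicator_def)
  finally show ?thesis .
qed

section \<open>Spherically convex domains and hemispheres\<close>

definition unstereo :: "complex \<times> real \<Rightarrow> riemann_sphere"
  where "unstereo q = (if snd q = 1 then None else Some (fst q /\<^sub>R (1 - snd q)))"

lemma unstereo_stereo: "unstereo (stereo p) = p"
proof (cases p)
  case (Some z)
  define N where "N = 1 + (cmod z)\<^sup>2"
  have N: "N > 0" unfolding N_def by (rule one_plus_cmod_sq_pos)
  have "((cmod z)\<^sup>2 - 1) / (1 + (cmod z)\<^sup>2) = 1 - 2 / N"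
    using N by (simp add: field_simps N_def)
  then have "stereo p = ((2 / N) *\<^sub>R z, 1 - 2 / N)" by (simp add: Some stereo_def flip: N_def)
  then show ?thesis using N by (simp add: Some unstereo_def)
qed (simp add: unstereo_def stereo_def)

lemma norm_stereo [simp]: "norm (stereo p) = 1"
proof (cases p)
  case (Some z)
  define N where "N = 1 + (cmod z)\<^sup>2"
  have N: "N > 0" and cz: "(cmod z)\<^sup>2 = N - 1" unfolding N_def using one_plus_cmod_sq_pos by auto
  have "stereo p = ((2 / N) *\<^sub>R z, (N - 2) / N)" by (simp add: Some stereo_def cz flip: N_def)
  then have "(norm (stereo p))\<^sup>2 = (norm ((2 / N) *\<^sub>R z))\<^sup>2 + ((N - 2) / N)\<^sup>2"
    by (simp only: norm_Pair) (simp add: power_divide)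
  also have "\<dots> = 4 / N\<^sup>2 * (N - 1) + ((N - 2) / N)\<^sup>2"
    using N by (simp add: power_mult_distrib power_divide flip: cz)
  also have "\<dots> = 1" using N by (simp add: field_simps power2_eq_square)
  finally show ?thesis using norm_ge_zero[of "stereo p"] by (simp add: power2_eq_1_iff)
qed (simp add: stereo_def norm_Pair)

lemma stereo_unstereo:
  assumes "norm q = 1" shows "stereo (unstereo q) = q"
proof -
  obtain x t where q: "q = (x, t)" by force
  have *: "(cmod x)\<^sup>2 = (1 - t) * (1 + t)"
    using assms by (simp add: q norm_Pair algebra_simps power2_eq_square)
  show ?thesis
  proof (cases "t = 1")
    case True
    then show ?thesis using * by (simp add: q unstereo_def stereo_def)
  next
    case False
    have "(cmod (x /\<^sub>R (1 - t)))\<^sup>2 = (cmod x)\<^sup>2 / (1 - t)\<^sup>2"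
      by (simp add: power_mult_distrib power_inverse divide_inverse mult.commute)
    also have "\<dots> = (1 + t) / (1 - t)" unfolding * using False by (simp add: power2_eq_square)
    finally have "(cmod (x /\<^sub>R (1 - t)))\<^sup>2 = (1 + t) / (1 - t)" .
    moreover have "1 + (1 + t) / (1 - t) = 2 / (1 - t)" "(1 + t) / (1 - t) - 1 = 2 * t / (1 - t)"
      using False by (simp_all add: field_simps)
    moreover have "(2 / (2 / (1 - t))) *\<^sub>R (x /\<^sub>R (1 - t)) = x"
      using False by (simp add: divide_inverse[symmetric])
    ultimately show ?thesis using False by (simp only: q unstereo_def stereo_def) simp
  qed
qed

lemma stereo_eq_iff: "stereo p = stereo q \<longleftrightarrow> p = q"
  by (metis unstereo_stereo)

text \<open>
  This makes perturbation arguments on the unit sphere available for open sets of the one-point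
  compactification. Near infinity it holds because \<open>\<bar>z\<bar>\<^sup>2 = (1 + t) / (1 - t)\<close> for the point at height \<open>t\<close> on the unit sphere, so points
  high enough on the sphere avoid any given compact subset of the plane.
\<close>

lemma unstereo_eventually:
  assumes \<Omega>: "openin sphere_topology \<Omega>" and p: "p \<in> \<Omega>"
  shows "\<forall>\<^sub>F q in nhds (stereo p). norm q = 1 \<longrightarrow> unstereo q \<in> \<Omega>"
proof -
  have open_fin: "open {w. Some w \<in> \<Omega>}" 
    using \<Omega> unfolding openin_Alexandroff_compactification
    by (auto simp: image_iff closed_def Compl_eq)
  show ?thesis
  proof (cases p)
    case (Some z)
    have t: "snd (stereo p) < 1" using one_plus_cmod_sq_pos[of z] by (simp add: Some stereo_def)
    have "((\<lambda>q. fst q /\<^sub>R (1 - snd q)) \<longlongrightarrow> fst (stereo p) /\<^sub>R (1 - snd (stereo p))) (nhds (stereo p))"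
      using t by (intro tendsto_intros filterlim_ident) auto
    moreover have "fst (stereo p) /\<^sub>R (1 - snd (stereo p)) \<in> {w. Some w \<in> \<Omega>}"
      using unstereo_stereo[of p] p t by (simp add: unstereo_def Some)
    ultimately have "\<forall>\<^sub>F q in nhds (stereo p). fst q /\<^sub>R (1 - snd q) \<in> {w. Some w \<in> \<Omega>}"
      using open_fin topological_tendstoD by blast
    moreover have "\<forall>\<^sub>F q in nhds (stereo p). snd q < 1"
      using t by (intro order_tendstoD(2)[OF tendsto_snd[OF filterlim_ident]])
    ultimately show ?thesis by eventually_elim (auto simp: unstereo_def)
  next
    case None
    then obtain C where "compact C" "\<Omega> = insert None (Some ` (- C))"
      using \<Omega> p unfolding openin_Alexandroff_compactification by (auto simp: Compl_eq_Diff_UNIV)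
    then obtain M where M: "\<And>w. M < cmod w \<Longrightarrow> Some w \<in> \<Omega>" "0 < M"
      using compact_imp_bounded bounded_pos by (metis ComplI image_eqI insertI2 not_less)
    have "\<forall>\<^sub>F q in nhds (stereo p). 1 - 1 / (1 + M\<^sup>2) < snd q"
      using M(2) by (intro order_tendstoD(1)[OF tendsto_snd[OF filterlim_ident]])
         (auto simp: None stereo_def add_pos_pos)
    then show ?thesis
    proof eventually_elim
      fix q :: "complex \<times> real" assume q: "1 - 1 / (1 + M\<^sup>2) < snd q"
      show "norm q = 1 \<longrightarrow> unstereo q \<in> \<Omega>"
      proof (cases "snd q = 1")
        case True then show ?thesis using p None by (simp add: unstereo_def)
      next
        case False
        show ?thesis
        proof
          assume nq: "norm q = 1"
          define t where "t = snd q"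
          have sq: "(cmod (fst q))\<^sup>2 = (1 - t) * (1 + t)"
            using nq by (simp add: norm_prod_def t_def algebra_simps power2_eq_square)
          have "\<bar>t\<bar> \<le> 1" using nq norm_snd_le[where x = "fst q" and y = "snd q"] by (simp add: t_def)
          then have t: "t < 1" "0 < 1 - t" using False by (auto simp: t_def)
          have M1: "0 < 1 + M\<^sup>2" using M(2) by (simp add: add_pos_pos)
          have "1 - t < 1 / (1 + M\<^sup>2)" using q by (simp add: t_def)
          then have "M\<^sup>2 * (1 - t) + (1 - t) < 1" using M1 by (simp add: field_simps)
          moreover have "1 \<le> 1 + t" 
          proof -
            have "1 / (1 + M\<^sup>2) \<le> 1" using M1 by simp
            then show ?thesis using q by (simp add: t_def)
          qed
          ultimately have "M\<^sup>2 * (1 - t) < 1 + t" using t by linarith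
          then have "M\<^sup>2 < (1 + t) / (1 - t)" using t by (simp add: field_simps)
          also have "\<dots> = (cmod (fst q))\<^sup>2 / (1 - t)\<^sup>2" unfolding sq using t by (simp add: power2_eq_square)
          also have "\<dots> = (cmod (fst q /\<^sub>R (1 - t)))\<^sup>2"
            by (simp add: power_mult_distrib power_inverse divide_inverse mult.commute)
          finally have "M < cmod (fst q /\<^sub>R (1 - t))"
            using norm_ge_zero power2_less_imp_less by blast
          then show "unstereo q \<in> \<Omega>" using M(1) False by (simp add: unstereo_def t_def)
        qed
      qed
    qed
  qed
qed

text \<open>
  Passing to the cone with apex \<open>0\<close> turns spherical convexity into convexity in the linear space
  \<^typ>\<open>complex \<times> real\<close>, where separation by a hyperplane is at hand.
\<close>

definition cone_over :: "riemann_sphere set \<Rightarrow> (complex \<times> real) set"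
  where "cone_over \<Omega> = {t *\<^sub>R stereo p | t p. 0 < t \<and> p \<in> \<Omega>}"

lemma scaleR_stereo_mem_cone_over_iff: "0 < t \<Longrightarrow> t *\<^sub>R stereo p \<in> cone_over \<Omega> \<longleftrightarrow> p \<in> \<Omega>"
proof
  assume "0 < t" and "t *\<^sub>R stereo p \<in> cone_over \<Omega>"
  then obtain s q where "0 < s" "q \<in> \<Omega>" and eq: "t *\<^sub>R stereo p = s *\<^sub>R stereo q" by (auto simp: cone_over_def)
  have "norm (t *\<^sub>R stereo p) = norm (s *\<^sub>R stereo q)" using eq by (rule arg_cong)
  then have "t = s" using \<open>0 < t\<close> \<open>0 < s\<close> by simp
  then show "p \<in> \<Omega>" using eq \<open>q \<in> \<Omega>\<close> \<open>0 < t\<close> by (simp add: stereo_eq_iff)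
qed (auto simp: cone_over_def)

lemma cone_over_perturb:
  assumes \<Omega>: "openin sphere_topology \<Omega>" and p: "p \<in> \<Omega>"
  obtains \<epsilon> where "0 < \<epsilon>" "stereo p + \<epsilon> *\<^sub>R w \<in> cone_over \<Omega>"
proof -
  let ?x = "\<lambda>\<epsilon>::real. stereo p + \<epsilon> *\<^sub>R w"
  have "(?x \<longlongrightarrow> stereo p + 0 *\<^sub>R w) (at_right 0)" by (intro tendsto_intros)
  then have x: "(?x \<longlongrightarrow> stereo p) (at_right 0)" by simp
  have "((\<lambda>\<epsilon>. ?x \<epsilon> /\<^sub>R norm (?x \<epsilon>)) \<longlongrightarrow> stereo p /\<^sub>R norm (stereo p)) (at_right 0)"
    by (intro tendsto_intros x) auto
  then have "((\<lambda>\<epsilon>. ?x \<epsilon> /\<^sub>R norm (?x \<epsilon>)) \<longlongrightarrow> stereo p) (at_right 0)" by simp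
  then have "\<forall>\<^sub>F \<epsilon> in at_right 0. norm (?x \<epsilon> /\<^sub>R norm (?x \<epsilon>)) = 1 \<longrightarrow> unstereo (?x \<epsilon> /\<^sub>R norm (?x \<epsilon>)) \<in> \<Omega>"
    using unstereo_eventually[OF \<Omega> p] eventually_compose_filterlim by fastforce
  moreover have "\<forall>\<^sub>F \<epsilon> in at_right 0. ?x \<epsilon> \<noteq> 0"
    using tendsto_imp_eventually_ne[OF x, of 0] norm_stereo[of p] by fastforce
  moreover have "\<forall>\<^sub>F \<epsilon> in at_right (0::real). 0 < \<epsilon>" by (simp add: eventually_at_right_less)
  ultimately have "\<forall>\<^sub>F \<epsilon> in at_right 0. 0 < \<epsilon> \<and> ?x \<epsilon> \<in> cone_over \<Omega>"
  proof eventually_elim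
    case (elim \<epsilon>)
    then have 1: "norm (?x \<epsilon> /\<^sub>R norm (?x \<epsilon>)) = 1" by simp
    have "?x \<epsilon> = norm (?x \<epsilon>) *\<^sub>R stereo (unstereo (?x \<epsilon> /\<^sub>R norm (?x \<epsilon>)))"
      unfolding stereo_unstereo[OF 1] using elim by simp
    then show ?case using elim 1 unfolding cone_over_def by (smt (verit) mem_Collect_eq zero_less_norm_iff)
  qed
  then show ?thesis using that eventually_happens' trivial_limit_at_right_real by blast
qed

text \<open>
  The unit tangent \<open>v\<close> at \<open>a\<close> comes from Gram-Schmidt. On the smaller arc from \<open>a\<close> to \<open>b\<close> one has
  \<open>sin l *\<^sub>R great_circle a v \<phi> = sin (l - \<phi>) *\<^sub>R a + sin \<phi> *\<^sub>R b\<close>, so \<open>\<phi>\<close> has to be chosen with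
  \<open>sin (l - \<phi>) : sin \<phi> = s : t\<close>, which the intermediate value theorem allows.
\<close>

lemma great_circle_arc_exists:
  fixes a b :: "complex \<times> real"
  assumes a: "norm a = 1" and b: "norm b = 1" and ne: "b \<noteq> a" "b \<noteq> - a" and s: "0 < s" and t: "0 < t"
  obtains v l \<phi> where "norm v = 1" "a \<bullet> v = 0" "0 \<le> l" "l < pi" "great_circle a v 0 = a"
    "great_circle a v l = b" "\<phi> \<in> {0..l}"
    "s *\<^sub>R a + t *\<^sub>R b = norm (s *\<^sub>R a + t *\<^sub>R b) *\<^sub>R great_circle a v \<phi>"
proof -
  define c where "c = a \<bullet> b"
  have aa: "a \<bullet> a = 1" "b \<bullet> b = 1" using a b by (simp_all add: dot_square_norm)
  have "0 < (norm (b - a))\<^sup>2" "0 < (norm (b + a))\<^sup>2" using ne by (auto simp: eq_neg_iff_add_eq_0)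
  then have c: "-1 < c" "c < 1"
    using aa by (simp_all add: power2_norm_eq_inner inner_simps c_def inner_commute)
  define l where "l = arccos c"
  have l: "0 < l" "l < pi" "cos l = c" unfolding l_def using c arccos_lt_bounded[of c] by auto
  have sl: "0 < sin l" using l sin_gt_zero by simp
  define v where "v = (b - c *\<^sub>R a) /\<^sub>R sin l"
  have slv: "sin l *\<^sub>R v = b - cos l *\<^sub>R a" using sl l by (simp add: v_def)
  have "(sin l)\<^sup>2 = 1 - c\<^sup>2" using l sin_squared_eq by metis
  also have "\<dots> = (b - c *\<^sub>R a) \<bullet> (b - c *\<^sub>R a)"
    using aa by (simp add: inner_simps inner_commute[of b a] power2_eq_square flip: c_def)
  also have "\<dots> = (sin l)\<^sup>2 * (v \<bullet> v)"
    unfolding slv[unfolded \<open>cos l = c\<close>, symmetric] by (simp add: power2_eq_square)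
  finally have "v \<bullet> v = 1" using sl by simp
  then have nv: "norm v = 1" by (simp add: norm_eq_1)
  have av: "a \<bullet> v = 0" using aa by (simp add: v_def inner_simps flip: c_def)
  have "\<exists>\<phi>\<ge>0. \<phi> \<le> l \<and> s * sin \<phi> - t * sin (l - \<phi>) = 0"
    using l sl s t by (intro IVT') (auto intro!: continuous_intros)
  then obtain \<phi> where \<phi>: "0 \<le> \<phi>" "\<phi> \<le> l" "s * sin \<phi> = t * sin (l - \<phi>)" by auto
  define \<kappa> where "\<kappa> = sin \<phi> / t"
  have "\<phi> \<noteq> 0" using \<phi>(3) sl t by auto
  then have "0 < sin \<phi>" using \<phi> l by (intro sin_gt_zero) auto
  then have \<kappa>: "0 < \<kappa>" "sin \<phi> = \<kappa> * t" "sin (l - \<phi>) = \<kappa> * s"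
    using t \<phi>(3) by (auto simp: \<kappa>_def field_simps)
  have "sin l *\<^sub>R great_circle a v \<phi> = (sin l * cos \<phi>) *\<^sub>R a + sin \<phi> *\<^sub>R (sin l *\<^sub>R v)"
    by (simp add: great_circle_def scaleR_add_right mult.commute)
  also have "\<dots> = sin (l - \<phi>) *\<^sub>R a + sin \<phi> *\<^sub>R b"
    unfolding slv by (simp add: sin_diff algebra_simps)
  also have "\<dots> = \<kappa> *\<^sub>R (s *\<^sub>R a + t *\<^sub>R b)" unfolding \<kappa> by (simp add: scaleR_add_right)
  finally have eq: "s *\<^sub>R a + t *\<^sub>R b = (sin l / \<kappa>) *\<^sub>R great_circle a v \<phi>"
    using \<kappa>(1) by (auto dest: arg_cong[where f = "(*\<^sub>R) (1 / \<kappa>)"])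
  have "great_circle a v \<phi> \<bullet> great_circle a v \<phi> = (cos \<phi>)\<^sup>2 + (sin \<phi>)\<^sup>2"
    using aa av \<open>v \<bullet> v = 1\<close> by (simp add: great_circle_def inner_simps inner_commute power2_eq_square)
  then have "norm (great_circle a v \<phi>) = 1" by (simp add: norm_eq_1)
  then have "norm (s *\<^sub>R a + t *\<^sub>R b) = sin l / \<kappa>" unfolding eq using sl \<kappa> by simp
  then have "s *\<^sub>R a + t *\<^sub>R b = norm (s *\<^sub>R a + t *\<^sub>R b) *\<^sub>R great_circle a v \<phi>" using eq by simp
  moreover have "great_circle a v 0 = a" "great_circle a v l = b"
    using slv by (simp_all add: great_circle_def)
  moreover have "0 \<le> l" "\<phi> \<in> {0..l}" using l \<phi> by auto
  ultimately show ?thesis using that nv av l(2) by blast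
qed

lemma cone_over_add:
  assumes \<Omega>: "spherically_convex \<Omega>" and pq: "p \<in> \<Omega>" "q \<in> \<Omega>" "stereo q \<noteq> - stereo p" and st: "0 < s" "0 < t"
  shows "s *\<^sub>R stereo p + t *\<^sub>R stereo q \<in> cone_over \<Omega>"
proof (cases "stereo q = stereo p")
  case True
  then have "s *\<^sub>R stereo p + t *\<^sub>R stereo q = (s + t) *\<^sub>R stereo p" by (simp add: scaleR_add_left)
  then show ?thesis using scaleR_stereo_mem_cone_over_iff[of "s+t"] st pq by simp
next
  case False
  let ?x = "s *\<^sub>R stereo p + t *\<^sub>R stereo q"
  obtain v l \<phi> where *: "norm v = 1" "stereo p \<bullet> v = 0" "0 \<le> l" "l < pi" "great_circle (stereo p) v 0 = stereo p"
    "great_circle (stereo p) v l = stereo q" "\<phi> \<in> {0..l}"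
    "?x = norm ?x *\<^sub>R great_circle (stereo p) v \<phi>"
    using great_circle_arc_exists[OF norm_stereo norm_stereo False pq(3) st] by metis
  have x: "?x \<noteq> 0"
  proof
    assume "?x = 0"
    then have e: "t *\<^sub>R stereo q = - (s *\<^sub>R stereo p)" by (simp add: add_eq_0_iff)
    then have "norm (t *\<^sub>R stereo q) = norm (- (s *\<^sub>R stereo p))" by (rule arg_cong)
    then have "t = s" using st by simp
    with e st have "t *\<^sub>R stereo q = t *\<^sub>R (- stereo p)" by simp
    then show False using st pq(3) by (metis less_irrefl real_vector.scale_left_imp_eq)
  qed
  have "norm ?x = norm (norm ?x *\<^sub>R great_circle (stereo p) v \<phi>)" using *(8) by (rule arg_cong)
  then have "norm ?x = norm ?x * norm (great_circle (stereo p) v \<phi>)" unfolding norm_scaleR by simp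
  then have ng: "norm (great_circle (stereo p) v \<phi>) = 1" using x by simp
  let ?c = "unstereo (great_circle (stereo p) v \<phi>)"
  have sc: "stereo ?c = great_circle (stereo p) v \<phi>" using stereo_unstereo[OF ng] .
  have "?c \<in> spherical_geodesic p q"
    unfolding spherical_geodesic_def mem_Collect_eq sc using * norm_stereo by blast
  then have "?c \<in> \<Omega>" using \<Omega> pq unfolding spherically_convex_def antipodal_def by blast
  then show ?thesis
    using scaleR_stereo_mem_cone_over_iff[of "norm ?x" ?c] x *(8) by (simp add: sc)
qed

text \<open>
  Let \<open>c\<close> be any third point. Moving \<open>p\<close> slightly towards \<open>c\<close> gives a point \<open>b\<close> of the open set
  \<open>\<Omega>\<close> which is no longer antipodal to \<open>q\<close>, and the geodesic from \<open>b\<close> to \<open>q\<close> runs through \<open>c\<close>.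
\<close>

lemma spherically_convex_antipodal_imp_UNIV:
  assumes \<Omega>: "spherically_convex \<Omega>" and pq: "p \<in> \<Omega>" "q \<in> \<Omega>" "stereo q = - stereo p"
  shows "\<Omega> = UNIV"
proof (rule UNIV_eq_I[symmetric])
  fix c
  have op: "openin sphere_topology \<Omega>" using \<Omega> by (simp add: spherically_convex_def sphere_domain_def)
  obtain \<epsilon> where \<epsilon>: "0 < \<epsilon>" "stereo p + \<epsilon> *\<^sub>R stereo c \<in> cone_over \<Omega>"
    using cone_over_perturb[OF op pq(1)] .
  then obtain m b where mb: "0 < m" "b \<in> \<Omega>" "stereo p + \<epsilon> *\<^sub>R stereo c = m *\<^sub>R stereo b"
    by (auto simp: cone_over_def)
  show "c \<in> \<Omega>"
  proof (cases "stereo b = stereo p")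
    case True
    then have eq: "\<epsilon> *\<^sub>R stereo c = (m - 1) *\<^sub>R stereo p" using mb(3) by (simp add: algebra_simps)
    then have "norm (\<epsilon> *\<^sub>R stereo c) = norm ((m - 1) *\<^sub>R stereo p)" by (rule arg_cong)
    then have "\<epsilon> = \<bar>m - 1\<bar>" using \<epsilon>(1) by simp
    then have "\<epsilon> *\<^sub>R stereo c = \<epsilon> *\<^sub>R stereo p \<or> \<epsilon> *\<^sub>R stereo c = \<epsilon> *\<^sub>R stereo q"
      using eq pq(3) by (cases "m < 1") (auto simp: abs_if, metis minus_diff_eq scaleR_minus_left)
    then have "stereo c = stereo p \<or> stereo c = stereo q" using \<epsilon>(1) by simp
    then show ?thesis using pq(1,2) by (auto simp: stereo_eq_iff)
  next
    case False
    \<comment> \<open>The direction of \<open>c\<close> is a positive combination of \<open>b\<close> and \<open>q\<close>.\<close>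
    have "\<epsilon> *\<^sub>R stereo c = m *\<^sub>R stereo b + 1 *\<^sub>R stereo q" using mb(3) pq(3) by (simp add: algebra_simps)
    also have "\<dots> \<in> cone_over \<Omega>" using False pq mb by (intro cone_over_add[OF \<Omega>]) auto
    finally show ?thesis using scaleR_stereo_mem_cone_over_iff \<epsilon>(1) by blast
  qed
qed

text \<open>
  Without antipodal pairs the cone over \<open>\<Omega>\<close> is convex and misses its apex, so a hyperplane through
  the apex bounds a half-space containing it. Since \<open>\<Omega>\<close> is open, it does not touch this
  hyperplane: the hemisphere can be taken open.
\<close>

lemma spherically_convex_subset_hemisphere:
  assumes \<Omega>: "spherically_convex \<Omega>" and ne: "\<Omega> \<noteq> UNIV"
  obtains c where "\<And>p. p \<in> \<Omega> \<Longrightarrow> 0 < stereo c \<bullet> stereo p"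
proof -
  have op: "openin sphere_topology \<Omega>" using \<Omega> by (simp add: spherically_convex_def sphere_domain_def)
  have cvx: "convex (cone_over \<Omega>)"
  proof (rule convexI)
    fix x y and u v :: real
    assume xy: "x \<in> cone_over \<Omega>" "y \<in> cone_over \<Omega>" and uv: "0 \<le> u" "0 \<le> v" "u + v = 1"
    obtain s p t q where *: "0 < s" "p \<in> \<Omega>" "x = s *\<^sub>R stereo p" "0 < t" "q \<in> \<Omega>" "y = t *\<^sub>R stereo q"
      using xy unfolding cone_over_def by blast
    show "u *\<^sub>R x + v *\<^sub>R y \<in> cone_over \<Omega>"
    proof (cases "u = 0 \<or> v = 0")
      case True then show ?thesis using xy uv by auto
    next
      case False
      then have "(u * s) *\<^sub>R stereo p + (v * t) *\<^sub>R stereo q \<in> cone_over \<Omega>"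
        using spherically_convex_antipodal_imp_UNIV[OF \<Omega> *(2,5)] ne * uv
        by (intro cone_over_add[OF \<Omega>]) auto
      then show ?thesis by (simp add: *)
    qed
  qed
  have "0 \<notin> cone_over \<Omega>"
  proof -
    have "stereo p \<noteq> 0" for p using norm_stereo[of p] by (metis norm_zero zero_neq_one)
    then show ?thesis by (auto simp: cone_over_def)
  qed
  then obtain n where n: "n \<noteq> 0" "\<And>x. x \<in> cone_over \<Omega> \<Longrightarrow> 0 \<le> n \<bullet> x"
    using separating_hyperplane_set_0[OF cvx] by auto
  have pos: "0 < n \<bullet> stereo p" if p: "p \<in> \<Omega>" for p
  proof -
    \<comment> \<open>A point with \<open>n \<bullet> stereo p = 0\<close> could be pushed out of the half-space.\<close>
    obtain \<epsilon> where \<epsilon>: "0 < \<epsilon>" "stereo p + \<epsilon> *\<^sub>R (- n) \<in> cone_over \<Omega>"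
      using cone_over_perturb[OF op p] .
    have "0 \<le> n \<bullet> (stereo p + \<epsilon> *\<^sub>R (- n))" using n(2) \<epsilon>(2) by blast
    moreover have "0 < \<epsilon> * (n \<bullet> n)" using \<epsilon>(1) n(1) by simp
    ultimately show ?thesis by (simp add: inner_simps)
  qed
  have "stereo (unstereo (n /\<^sub>R norm n)) = n /\<^sub>R norm n" using n(1) by (intro stereo_unstereo) simp
  then have "0 < stereo (unstereo (n /\<^sub>R norm n)) \<bullet> stereo p" if "p \<in> \<Omega>" for p
    using pos[OF that] n(1) by simp
  then show ?thesis using that by blast
qed

section \<open>Rotations of the sphere\<close>

text \<open>
  The columns of the matrix \<open>((\<alpha>, \<beta>), (\<gamma>, \<delta>))\<close> are orthogonal and of equal length, so the matrix is a
  nonzero multiple of a unitary one and its Moebius transformation is a rotation of the sphere.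
  Allowing a multiple avoids square roots in the coefficients.
\<close>

definition unitary_coeffs :: "complex \<Rightarrow> complex \<Rightarrow> complex \<Rightarrow> complex \<Rightarrow> bool"
  where "unitary_coeffs \<alpha> \<beta> \<gamma> \<delta> \<longleftrightarrow>
    (cmod \<alpha>)\<^sup>2 + (cmod \<gamma>)\<^sup>2 = (cmod \<beta>)\<^sup>2 + (cmod \<delta>)\<^sup>2 \<and> cnj \<alpha> * \<beta> + cnj \<gamma> * \<delta> = 0 \<and> (\<gamma> \<noteq> 0 \<or> \<delta> \<noteq> 0)"

lemma unitary_coeffs_norm:
  assumes "unitary_coeffs \<alpha> \<beta> \<gamma> \<delta>"
  shows "(cmod (\<alpha> * w + \<beta>))\<^sup>2 + (cmod (\<gamma> * w + \<delta>))\<^sup>2 = ((cmod \<alpha>)\<^sup>2 + (cmod \<gamma>)\<^sup>2) * (1 + (cmod w)\<^sup>2)"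
proof -
  have E: "cnj \<alpha> * \<beta> + cnj \<gamma> * \<delta> = 0" using assms by (simp add: unitary_coeffs_def)
  then have "cnj (cnj \<alpha> * \<beta> + cnj \<gamma> * \<delta>) = cnj 0" by (rule arg_cong)
  then have E': "\<alpha> * cnj \<beta> + \<gamma> * cnj \<delta> = 0" by simp
  have N: "\<alpha> * cnj \<alpha> + \<gamma> * cnj \<gamma> = \<beta> * cnj \<beta> + \<delta> * cnj \<delta>"
    using assms unfolding unitary_coeffs_def complex_norm_square[symmetric] of_real_add[symmetric] by simp
  have "(\<alpha> * w + \<beta>) * cnj (\<alpha> * w + \<beta>) + (\<gamma> * w + \<delta>) * cnj (\<gamma> * w + \<delta>)
      = (\<alpha> * cnj \<alpha> + \<gamma> * cnj \<gamma>) * (w * cnj w) + (\<beta> * cnj \<beta> + \<delta> * cnj \<delta>)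
        + cnj w * (cnj \<alpha> * \<beta> + cnj \<gamma> * \<delta>) + w * (\<alpha> * cnj \<beta> + \<gamma> * cnj \<delta>)"
    by (simp add: algebra_simps)
  also have "\<dots> = (\<alpha> * cnj \<alpha> + \<gamma> * cnj \<gamma>) * (1 + w * cnj w)"
    unfolding E E' N[symmetric] by (simp add: algebra_simps)
  finally have "complex_of_real ((cmod (\<alpha> * w + \<beta>))\<^sup>2 + (cmod (\<gamma> * w + \<delta>))\<^sup>2)
      = complex_of_real (((cmod \<alpha>)\<^sup>2 + (cmod \<gamma>)\<^sup>2) * (1 + (cmod w)\<^sup>2))"
    by (simp only: of_real_add of_real_mult of_real_1 complex_norm_square)
  then show ?thesis by (simp only: of_real_eq_iff)
qed

lemma unitary_coeffs_det:
  assumes "unitary_coeffs \<alpha> \<beta> \<gamma> \<delta>"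
  shows "cmod (\<alpha> * \<delta> - \<beta> * \<gamma>) = (cmod \<alpha>)\<^sup>2 + (cmod \<gamma>)\<^sup>2"
proof -
  have E: "cnj \<alpha> * \<beta> + cnj \<gamma> * \<delta> = 0" 
    using assms by (auto simp: unitary_coeffs_def)
  have N: "\<alpha> * cnj \<alpha> + \<gamma> * cnj \<gamma> = \<beta> * cnj \<beta> + \<delta> * cnj \<delta>"
    using assms unfolding unitary_coeffs_def complex_norm_square[symmetric] of_real_add[symmetric] by simp
  have "(\<alpha> * \<delta> - \<beta> * \<gamma>) * cnj (\<alpha> * \<delta> - \<beta> * \<gamma>)
     = (\<alpha> * cnj \<alpha> + \<gamma> * cnj \<gamma>) * (\<beta> * cnj \<beta> + \<delta> * cnj \<delta>)
       - (cnj \<alpha> * \<beta> + cnj \<gamma> * \<delta>) * cnj (cnj \<alpha> * \<beta> + cnj \<gamma> * \<delta>)"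
    by (simp add: algebra_simps)
  also have "\<dots> = (\<alpha> * cnj \<alpha> + \<gamma> * cnj \<gamma>)\<^sup>2"
    unfolding E N[symmetric] by (simp add: power2_eq_square)
  finally have "(cmod (\<alpha> * \<delta> - \<beta> * \<gamma>))\<^sup>2 = ((cmod \<alpha>)\<^sup>2 + (cmod \<gamma>)\<^sup>2)\<^sup>2"
    unfolding complex_norm_square[symmetric] of_real_add[symmetric] of_real_mult[symmetric]
      of_real_power[symmetric] of_real_eq_iff .
  then show ?thesis using power2_eq_imp_eq by (metis norm_ge_zero add_nonneg_nonneg zero_le_power2)
qed

lemma unitary_coeffs_pos:
  assumes "unitary_coeffs \<alpha> \<beta> \<gamma> \<delta>"
  shows "0 < (cmod \<alpha>)\<^sup>2 + (cmod \<gamma>)\<^sup>2"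
  using assms unfolding unitary_coeffs_def
  by (metis add_pos_nonneg add_nonneg_pos zero_le_power2 zero_less_norm_iff zero_less_power)

lemma unitary_coeffs_det_nz: "unitary_coeffs \<alpha> \<beta> \<gamma> \<delta> \<Longrightarrow> \<alpha> * \<delta> - \<beta> * \<gamma> \<noteq> 0"
  using unitary_coeffs_det unitary_coeffs_pos by (metis less_irrefl norm_zero)

text \<open>
  Rotations preserve the spherical metric. The derivative of the Moebius transformation is
  \<open>(\<alpha> \<delta> - \<beta> \<gamma>) / (\<gamma> w + \<delta>)\<^sup>2\<close>, and if \<open>N\<close> is the squared length of the columns, both the modulus of the determinant and the factor in
  \<open>\<bar>\<alpha> w + \<beta>\<bar>\<^sup>2 + \<bar>\<gamma> w + \<delta>\<bar>\<^sup>2 = N (1 + \<bar>w\<bar>\<^sup>2)\<close> are \<open>N\<close>, so they cancel.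
\<close>

lemma unitary_coeffs_spherical_deriv:
  assumes u: "unitary_coeffs \<alpha> \<beta> \<gamma> \<delta>" and U: "open U" "z \<in> U" and k: "k holomorphic_on U"
    and h: "\<And>w. w \<in> U \<Longrightarrow> \<gamma> * k w + \<delta> \<noteq> 0 \<and> h w = (\<alpha> * k w + \<beta>) / (\<gamma> * k w + \<delta>)"
  shows "cmod (deriv h z) / (1 + (cmod (h z))\<^sup>2) = cmod (deriv k z) / (1 + (cmod (k z))\<^sup>2)"
proof -
  define N where "N = (cmod \<alpha>)\<^sup>2 + (cmod \<gamma>)\<^sup>2"
  define D where "D = \<gamma> * k z + \<delta>"
  have N: "0 < N" unfolding N_def by (rule unitary_coeffs_pos[OF u])
  have D: "D \<noteq> 0" and hz: "h z = (\<alpha> * k z + \<beta>) / D" using h[OF U(2)] by (auto simp: D_def)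
  have k': "(k has_field_derivative deriv k z) (at z)" using k U holomorphic_derivI by blast
  have "((\<lambda>w. (\<alpha> * k w + \<beta>) / (\<gamma> * k w + \<delta>)) has_field_derivative
      ((\<alpha> * deriv k z) * (\<gamma> * k z + \<delta>) - (\<alpha> * k z + \<beta>) * (\<gamma> * deriv k z)) / ((\<gamma> * k z + \<delta>) * (\<gamma> * k z + \<delta>))) (at z)"
    using D unfolding D_def by (auto intro!: derivative_eq_intros k')
  then have "(h has_field_derivative 
      ((\<alpha> * deriv k z) * (\<gamma> * k z + \<delta>) - (\<alpha> * k z + \<beta>) * (\<gamma> * deriv k z)) / ((\<gamma> * k z + \<delta>) * (\<gamma> * k z + \<delta>))) (at z)"
    by (rule has_field_derivative_transform_within_open[OF _ U]) (use h in auto)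
  moreover have "((\<alpha> * deriv k z) * (\<gamma> * k z + \<delta>) - (\<alpha> * k z + \<beta>) * (\<gamma> * deriv k z)) / ((\<gamma> * k z + \<delta>) * (\<gamma> * k z + \<delta>))
      = (\<alpha> * \<delta> - \<beta> * \<gamma>) * deriv k z / D\<^sup>2"
    by (simp add: D_def power2_eq_square algebra_simps)
  ultimately have "deriv h z = (\<alpha> * \<delta> - \<beta> * \<gamma>) * deriv k z / D\<^sup>2"
    by (simp add: DERIV_imp_deriv)
  then have dh: "cmod (deriv h z) = N * cmod (deriv k z) / (cmod D)\<^sup>2"
    using unitary_coeffs_det[OF u] by (simp add: norm_mult norm_divide norm_power N_def)
  have "(cmod D)\<^sup>2 * (1 + (cmod (h z))\<^sup>2) = (cmod (\<alpha> * k z + \<beta>))\<^sup>2 + (cmod (\<gamma> * k z + \<delta>))\<^sup>2"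
    using D unfolding hz D_def[symmetric] by (simp add: norm_divide power_divide distrib_left)
  also have "\<dots> = N * (1 + (cmod (k z))\<^sup>2)"
    unfolding unitary_coeffs_norm[OF u] N_def ..
  finally have "cmod (deriv h z) / (1 + (cmod (h z))\<^sup>2) = N * cmod (deriv k z) / (N * (1 + (cmod (k z))\<^sup>2))"
    unfolding dh by simp
  then show ?thesis using N by simp
qed

lemma moebius_inverse:
  assumes "\<alpha> * \<delta> - \<beta> * \<gamma> \<noteq> 0"
  shows "moebius \<delta> (-\<beta>) (-\<gamma>) \<alpha> (moebius \<alpha> \<beta> \<gamma> \<delta> p) = p"
proof (cases p)
  case None
  then show ?thesis using assms by (auto simp: moebius_def field_simps)
next
  case (Some z)
  show ?thesis
  proof (cases "\<gamma> * z + \<delta> = 0")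
    case True
    then have \<delta>: "\<delta> = - \<gamma> * z" by (simp add: add_eq_0_iff)
    then have "\<gamma> \<noteq> 0" using assms by auto
    then show ?thesis using Some \<delta> by (simp add: moebius_def)
  next
    case False
    have 1: "- \<gamma> * ((\<alpha> * z + \<beta>) / (\<gamma> * z + \<delta>)) + \<alpha> = (\<alpha> * \<delta> - \<beta> * \<gamma>) / (\<gamma> * z + \<delta>)"
      using False by (simp add: field_simps)
    have 2: "\<delta> * ((\<alpha> * z + \<beta>) / (\<gamma> * z + \<delta>)) + - \<beta> = z * (\<alpha> * \<delta> - \<beta> * \<gamma>) / (\<gamma> * z + \<delta>)"
      using False by (simp add: field_simps)
    show ?thesis using Some False assms unfolding moebius_def
      by (simp add: 1[simplified] 2[simplified])
  qed
qed

text \<open>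
  Rotations that take a given point of the sphere to the origin: the point is \<open>a\<close> in the first case
  and \<open>\<infinity>\<close> in the second one.
\<close>

definition rotation_coeffs :: "complex \<Rightarrow> complex \<Rightarrow> complex \<Rightarrow> complex \<Rightarrow> bool"
  where "rotation_coeffs \<alpha> \<beta> \<gamma> \<delta> \<longleftrightarrow>
    (\<exists>a. \<alpha> = 1 \<and> \<beta> = - a \<and> \<gamma> = cnj a \<and> \<delta> = 1) \<or> (\<alpha> = 0 \<and> \<beta> = 1 \<and> \<gamma> = 1 \<and> \<delta> = 0)"

text \<open>
  The rotation taking the centre \<open>c\<close> of the hemisphere to \<open>0\<close> takes the hemisphere to the unit disc.
  For finite \<open>c = a\<close> and \<open>p = z\<close> this is the identity
  \<open>(1 + \<bar>a\<bar>\<^sup>2) (1 + \<bar>z\<bar>\<^sup>2) (stereo c \<bullet> stereo p) = \<bar>1 + cnj a z\<bar>\<^sup>2 - \<bar>z - a\<bar>\<^sup>2\<close>.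
\<close>

lemma hemisphere_to_disc:
  obtains \<alpha> \<beta> \<gamma> \<delta> where "rotation_coeffs \<alpha> \<beta> \<gamma> \<delta>"
    "\<And>p. 0 < stereo c \<bullet> stereo p \<Longrightarrow> \<exists>w. moebius \<alpha> \<beta> \<gamma> \<delta> p = Some w \<and> cmod w < 1"
proof (cases c)
  case None
  have "\<exists>w. moebius 0 1 1 0 p = Some w \<and> cmod w < 1" if p: "0 < stereo c \<bullet> stereo p" for p
  proof (cases p)
    case (Some z)
    then have "1 < (cmod z)\<^sup>2" using p None one_plus_cmod_sq_pos[of z]
      by (simp add: stereo_def zero_less_divide_iff)
    then have "1 < cmod z" using power2_less_imp_less[of 1 "cmod z"] by simp
    then show ?thesis using Some by (auto simp: moebius_def norm_divide)
  qed (auto simp: moebius_def)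
  then show ?thesis using that[of 0 1 1 0] by (simp add: rotation_coeffs_def)
next
  case (Some a)
  define A where "A = 1 + (cmod a)\<^sup>2"
  have A: "0 < A" unfolding A_def by (rule one_plus_cmod_sq_pos)
  have "\<exists>w. moebius 1 (- a) (cnj a) 1 p = Some w \<and> cmod w < 1" if p: "0 < stereo c \<bullet> stereo p" for p
  proof (cases p)
    case None
    then have "1 < (cmod a)\<^sup>2" using p Some one_plus_cmod_sq_pos[of a]
      by (simp add: stereo_def zero_less_divide_iff)
    then have "1 < cmod a" using power2_less_imp_less[of 1 "cmod a"] by simp
    then show ?thesis using None by (auto simp: moebius_def norm_divide)
  next
    case p': (Some z)
    define Z where "Z = 1 + (cmod z)\<^sup>2"
    have Z: "0 < Z" unfolding Z_def by (rule one_plus_cmod_sq_pos)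
    have s: "stereo c = ((2 / A) *\<^sub>R a, (A - 2) / A)" "stereo p = ((2 / Z) *\<^sub>R z, (Z - 2) / Z)"
      by (simp_all add: Some p' stereo_def A_def Z_def)
    have "A * Z * (stereo c \<bullet> stereo p) = 4 * (a \<bullet> z) + (A - 2) * (Z - 2)"
      using A Z unfolding s by (simp add: field_simps)
    also have "\<dots> = (cmod (cnj a * z + 1))\<^sup>2 - (cmod (z - a))\<^sup>2"
      unfolding A_def Z_def cmod_power2 inner_complex_def by (simp add: power2_eq_square algebra_simps)
    finally have "(cmod (z - a))\<^sup>2 < (cmod (cnj a * z + 1))\<^sup>2"
      using p A Z by (metis diff_gt_0_iff_gt mult_pos_pos)
    then have "cmod (z - a) < cmod (cnj a * z + 1)" by (rule power2_less_imp_less) simp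
    then show ?thesis using p' by (auto simp: moebius_def norm_divide divide_less_eq)
  qed
  then show ?thesis using that[of 1 "- a" "cnj a" 1] by (simp add: rotation_coeffs_def)
qed

lemma rotation_coeffs_imp_unitary_coeffs:
  "rotation_coeffs \<alpha> \<beta> \<gamma> \<delta> \<Longrightarrow>
   unitary_coeffs \<alpha> \<beta> \<gamma> \<delta>"
  by (auto simp: rotation_coeffs_def unitary_coeffs_def)

text \<open>
  The rows of a multiple of a unitary matrix are orthogonal and of equal length like its columns,
  and the columns of the adjugate matrix are these rows turned by a right angle.
\<close>

lemma unitary_coeffs_inverse:
  assumes u: "unitary_coeffs \<alpha> \<beta> \<gamma> \<delta>" shows "unitary_coeffs \<delta> (-\<beta>) (-\<gamma>) \<alpha>"
proof -
  have E: "cnj \<alpha> * \<beta> + cnj \<gamma> * \<delta> = 0" and n: "(cmod \<alpha>)\<^sup>2 + (cmod \<gamma>)\<^sup>2 = (cmod \<beta>)\<^sup>2 + (cmod \<delta>)\<^sup>2"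
    using u by (auto simp: unitary_coeffs_def)
  have "cmod (cnj \<alpha> * \<beta>) = cmod (cnj \<gamma> * \<delta>)"
    using E by (metis add_eq_0_iff norm_minus_cancel)
  then have m: "(cmod \<alpha>)\<^sup>2 * (cmod \<beta>)\<^sup>2 = (cmod \<gamma>)\<^sup>2 * (cmod \<delta>)\<^sup>2"
    by (simp add: norm_mult flip: power_mult_distrib)
  have "((cmod \<alpha>)\<^sup>2 + (cmod \<gamma>)\<^sup>2) * ((cmod \<alpha>)\<^sup>2 - (cmod \<delta>)\<^sup>2)
      = (cmod \<alpha>)\<^sup>2 * (cmod \<alpha>)\<^sup>2 + (cmod \<alpha>)\<^sup>2 * (cmod \<gamma>)\<^sup>2 - (cmod \<alpha>)\<^sup>2 * (cmod \<delta>)\<^sup>2 - (cmod \<alpha>)\<^sup>2 * (cmod \<beta>)\<^sup>2"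
    using m by (simp add: algebra_simps)
  also have "\<dots> = (cmod \<alpha>)\<^sup>2 * (((cmod \<alpha>)\<^sup>2 + (cmod \<gamma>)\<^sup>2) - ((cmod \<beta>)\<^sup>2 + (cmod \<delta>)\<^sup>2))"
    by (simp add: algebra_simps)
  also have "\<dots> = 0" unfolding n by simp
  finally have ad: "(cmod \<alpha>)\<^sup>2 = (cmod \<delta>)\<^sup>2" using unitary_coeffs_pos[OF u] by auto
  then have bg: "(cmod \<gamma>)\<^sup>2 = (cmod \<beta>)\<^sup>2" using n by simp
  have "- cnj \<delta> * \<beta> - cnj \<gamma> * \<alpha> = 0"
  proof (cases "\<alpha> = 0")
    case True then show ?thesis using ad by simp
  next
    case False
    have aa: "\<alpha> * cnj \<alpha> = \<delta> * cnj \<delta>" using ad by (simp flip: complex_norm_square)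
    have "cnj \<alpha> * (cnj \<delta> * \<beta> + cnj \<gamma> * \<alpha>) = cnj \<delta> * (cnj \<alpha> * \<beta>) + cnj \<gamma> * (\<alpha> * cnj \<alpha>)"
      by (simp add: algebra_simps)
    also have "\<dots> = cnj \<delta> * (cnj \<alpha> * \<beta> + cnj \<gamma> * \<delta>)" unfolding aa by (simp add: algebra_simps)
    finally have "cnj \<delta> * \<beta> + cnj \<gamma> * \<alpha> = 0" using E False by simp
    then show ?thesis by (simp add: algebra_simps add_eq_0_iff)
  qed
  then show ?thesis using ad bg u by (auto simp: unitary_coeffs_def)
qed

lemma finite_subsingleton:
  assumes "\<And>x y. x \<in> A \<Longrightarrow> y \<in> A \<Longrightarrow> x = y" shows "finite A"
proof (cases "A = {}")
  case False
  then obtain x where "x \<in> A" by blast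
  then have "A = {x}" using assms by blast
  then show ?thesis by simp
qed simp

text \<open>
  Where \<open>f\<close> is finite, the spherical derivatives of \<open>f\<close> and \<open>h\<close> agree. As \<open>h\<close> is injective, \<open>f\<close>
  has at most one pole in the disc, and a single point does not affect the integral.
\<close>

lemma image_area_moebius:
  assumes u: "unitary_coeffs \<alpha> \<beta> \<gamma> \<delta>" and r: "r \<le> 1"
    and h: "h holomorphic_on ball 0 1" "inj_on h (ball 0 1)"
    and f: "\<And>z. z \<in> ball 0 1 \<Longrightarrow> f z = moebius \<alpha> \<beta> \<gamma> \<delta> (Some (h z))"
  shows "image_area f r = (\<integral>\<^sup>+z\<in>ball 0 r. ennreal ((cmod (deriv h z) / (1 + (cmod (h z))\<^sup>2))\<^sup>2) \<partial>lborel)"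
proof -
  define K where "K = {z \<in> ball 0 1. \<gamma> * h z + \<delta> = 0}"
  have "z = w" if "z \<in> K" "w \<in> K" for z w
  proof -
    have "\<gamma> * h z + \<delta> = \<gamma> * h w + \<delta>" using that by (simp add: K_def)
    then have "\<gamma> * h z = \<gamma> * h w" by simp
    moreover have "\<gamma> \<noteq> 0" using that u by (auto simp: K_def unitary_coeffs_def)
    ultimately show ?thesis using that h(2) by (auto simp: K_def inj_on_def)
  qed
  then have finK: "finite K" by (rule finite_subsingleton)
  have opn: "open (ball 0 1 - K)" using finK by (simp add: finite_imp_closed open_Diff)
  have eq: "spherical_deriv f z = cmod (deriv h z) / (1 + (cmod (h z))\<^sup>2)" if z: "z \<in> ball 0 1 - K" for z
  proof -
    have S: "f w = Some ((\<alpha> * h w + \<beta>) / (\<gamma> * h w + \<delta>))" "\<gamma> * h w + \<delta> \<noteq> 0" if "w \<in> ball 0 1 - K" for w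
      using f[of w] that by (auto simp: moebius_def K_def)
    have "cmod (deriv (finite_part f) z) / (1 + (cmod (finite_part f z))\<^sup>2) = cmod (deriv h z) / (1 + (cmod (h z))\<^sup>2)"
      by (rule unitary_coeffs_spherical_deriv[OF u opn z])
        (use S h holomorphic_on_subset in \<open>auto simp: finite_part_def\<close>)
    then show ?thesis using S[OF z] by (simp add: spherical_deriv_def Let_def)
  qed
  have "AE z in lborel. z \<notin> K"
    using finite_imp_null_set_lborel[OF finK] AE_not_in by blast
  then show ?thesis unfolding image_area_def
    by (intro nn_integral_cong_AE) (use eq r in \<open>auto elim!: eventually_mono simp: indicator_def\<close>)
qed

text \<open>
  An isometry is a rotation of the identity map, whose spherical derivative is the density of the
  spherical area.
\<close>

lemma image_area_spherical_isometry:
  assumes "spherical_isometry f" "r \<le> 1" shows "image_area f r = disc_area r"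
proof -
  obtain \<alpha> \<beta> \<gamma> \<delta> where u: "unitary_coeffs \<alpha> \<beta> \<gamma> \<delta>" 
    and f: "\<And>z. z \<in> ball 0 1 \<Longrightarrow> f z = moebius \<alpha> \<beta> \<gamma> \<delta> (Some z)"
  proof -
    obtain \<rho> where \<rho>: "\<rho> \<in> Rot" "\<And>z. z \<in> ball 0 1 \<Longrightarrow> f z = \<rho> (Some z)"
      using assms unfolding spherical_isometry_def by blast
    have "unitary_coeffs (cis \<theta>) (- (cis \<theta> * a)) (cnj a) 1" for \<theta> a
      by (simp add: unitary_coeffs_def norm_mult cis_cnj) (simp add: cis_mult flip: mult.assoc)
    moreover have "unitary_coeffs 0 (cis \<theta>) 1 0" for \<theta> by (simp add: unitary_coeffs_def)
    ultimately show ?thesis using \<rho> that unfolding Rot_def by blast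
  qed
  show ?thesis
    using image_area_moebius[OF u assms(2), of "\<lambda>z. z" f] f
    by (simp add: disc_area_def power_divide inj_on_def)
qed

section \<open>Rotating the image into the unit disc\<close>

text \<open>
  Injectivity leaves room for one pole at most. That the image is not the whole sphere holds because
  the disc is not conformally equivalent to it: if \<open>f\<close> were onto, its finite part would be
  an injective holomorphic function with all of the plane as image, and the inverse would be a bounded
  entire function, hence constant by Liouville's theorem.
\<close>

lemma injective_sphere_meromorphic:
  assumes mero: "sphere_meromorphic_on f (ball 0 1)" and inj: "inj_on f (ball 0 1)"
  shows "f ` ball 0 1 \<noteq> UNIV" 
    and "finite {z \<in> ball 0 1. f z = None}"
    and "finite_part f holomorphic_on ball 0 1 - {z \<in> ball 0 1. f z = None}"
proof -
  define K where "K = {z \<in> ball 0 1. f z = None}"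
  define g where "g = finite_part f"
  have "z = w" if "z \<in> K" "w \<in> K" for z w using that inj by (auto simp: K_def inj_on_def)
  then have finK: "finite K" by (rule finite_subsingleton)
  then show "finite {z \<in> ball 0 1. f z = None}" by (simp add: K_def)
  have opn: "open (ball 0 1 - K)" using finK by (simp add: finite_imp_closed open_Diff)
  have "g analytic_on {z}" if "z \<in> ball 0 1 - K" for z
  proof -
    have z: "z \<in> ball 0 1" "f z \<noteq> None" using that by (auto simp: K_def)
    then have "\<not> is_pole g z" using mero unfolding sphere_meromorphic_on_def g_def by metis
    then show ?thesis
      using z(1) mero nicely_meromorphic_on_imp_analytic_at unfolding sphere_meromorphic_on_def g_def by blast
  qed
  then have holo: "g holomorphic_on ball 0 1 - K"
    using analytic_on_analytic_at analytic_imp_holomorphic by blast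
  then show "finite_part f holomorphic_on ball 0 1 - {z \<in> ball 0 1. f z = None}"
    by (simp add: g_def K_def)
  have fg: "f z = Some (g z)" if "z \<in> ball 0 1 - K" for z
    using that by (auto simp: g_def K_def finite_part_def split: option.splits)
  show "f ` ball 0 1 \<noteq> UNIV"
  proof
    assume onto: "f ` ball 0 1 = UNIV"
    have gonto: "\<exists>z\<in>ball 0 1 - K. g z = w" for w
    proof -
      obtain z where "z \<in> ball 0 1" "f z = Some w" using onto by (metis UNIV_I imageE)
      then show ?thesis using fg[of z] by (auto simp: K_def)
    qed
    have injg: "inj_on g (ball 0 1 - K)"
    proof (rule inj_onI)
      fix z w assume zw: "z \<in> ball 0 1 - K" "w \<in> ball 0 1 - K" "g z = g w"
      have "f z = f w" using fg[OF zw(1)] fg[OF zw(2)] zw(3) by simp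
      then show "z = w" using inj_onD[OF inj, of z w] zw(1,2) by blast
    qed
    have "\<exists>\<phi>. \<phi> holomorphic_on g ` (ball 0 1 - K) \<and> (\<forall>z\<in>ball 0 1 - K. \<phi> (g z) = z)"
    proof (rule holomorphic_has_inverse[OF holo opn injg])
      fix \<psi> assume "\<psi> holomorphic_on g ` (ball 0 1 - K)" "\<And>z. z \<in> ball 0 1 - K \<Longrightarrow> \<psi> (g z) = z"
      then show ?thesis by (intro exI[of _ \<psi>] conjI ballI)
    qed
    then obtain \<phi> where \<phi>: "\<phi> holomorphic_on g ` (ball 0 1 - K)" "\<forall>z\<in>ball 0 1 - K. \<phi> (g z) = z"
      by (elim exE conjE)
    have "w \<in> g ` (ball 0 1 - K)" for w using gonto[of w] by blast
    then have img: "g ` (ball 0 1 - K) = UNIV" by blast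
    have "\<phi> w \<in> ball 0 1" for w using gonto[of w] \<phi>(2) by force
    then have "bounded (range \<phi>)" by (intro bounded_subset[OF bounded_ball]) blast
    then have "\<phi> constant_on UNIV" using Liouville_theorem[of \<phi>] \<phi>(1) img by simp
    then have "\<phi> 0 = \<phi> 1" by (auto simp: constant_on_def)
    moreover obtain z w where "z \<in> ball 0 1 - K" "g z = 0" "w \<in> ball 0 1 - K" "g w = 1"
      using gonto by meson
    ultimately show False using \<phi>(2) by (metis zero_neq_one)
  qed
qed

text \<open>
  The image of \<open>f\<close> lies in a hemisphere, so after a rotation \<open>f\<close> becomes a function \<open>h\<close> into the unit
  disc. At a pole of \<open>f\<close> it is continuous with value \<open>\<alpha> / \<gamma>\<close>, so the singularity there is removable.
\<close>

lemma spherically_convex_map_rotate_into_disc: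
  assumes "spherically_convex_map f"
  obtains \<alpha> \<beta> \<gamma> \<delta> h where
    "rotation_coeffs \<alpha> \<beta> \<gamma> \<delta>"
    "h holomorphic_on ball 0 1" "inj_on h (ball 0 1)" "h ` ball 0 1 \<subseteq> ball 0 1"
    "\<And>z. z \<in> ball 0 1 \<Longrightarrow> f z = moebius \<delta> (-\<beta>) (-\<gamma>) \<alpha> (Some (h z))"
proof -
  have mero: "sphere_meromorphic_on f (ball 0 1)" and inj: "inj_on f (ball 0 1)" 
    and cvx: "spherically_convex (f ` ball 0 1)"
    using assms by (auto simp: spherically_convex_map_def)
  define K where "K = {z \<in> ball 0 1. f z = None}"
  define g where "g = finite_part f"
  have finK: "finite K" and holg: "g holomorphic_on ball 0 1 - K"
    using injective_sphere_meromorphic(2,3)[OF mero inj] by (simp_all add: K_def g_def)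
  have opn: "open (ball 0 1 - K)" using finK by (simp add: finite_imp_closed open_Diff)
  have fg: "f z = Some (g z)" if "z \<in> ball 0 1 - K" for z
    using that by (auto simp: g_def K_def finite_part_def split: option.splits)
  obtain c where c: "\<And>p. p \<in> f ` ball 0 1 \<Longrightarrow> 0 < stereo c \<bullet> stereo p"
    using spherically_convex_subset_hemisphere[OF cvx injective_sphere_meromorphic(1)[OF mero inj]] by blast
  obtain \<alpha> \<beta> \<gamma> \<delta> where co: "rotation_coeffs \<alpha> \<beta> \<gamma> \<delta>"
    and disc: "\<And>p. 0 < stereo c \<bullet> stereo p \<Longrightarrow> \<exists>w. moebius \<alpha> \<beta> \<gamma> \<delta> p = Some w \<and> cmod w < 1"
    using hemisphere_to_disc[of c] by blast
  have u: "unitary_coeffs \<alpha> \<beta> \<gamma> \<delta>" using rotation_coeffs_imp_unitary_coeffs[OF co] .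
  define h where "h = (\<lambda>z. the (moebius \<alpha> \<beta> \<gamma> \<delta> (f z)))"
  have h: "moebius \<alpha> \<beta> \<gamma> \<delta> (f z) = Some (h z)" "cmod (h z) < 1" if "z \<in> ball 0 1" for z
    using disc[OF c[OF imageI[OF that]]] by (auto simp: h_def)
  have fh: "f z = moebius \<delta> (-\<beta>) (-\<gamma>) \<alpha> (Some (h z))" if "z \<in> ball 0 1" for z
    using moebius_inverse[OF unitary_coeffs_det_nz[OF u], of "f z"] h(1)[OF that] by simp
  have injh: "inj_on h (ball 0 1)" using inj fh by (metis (no_types, lifting) inj_on_def)
  have hg: "\<gamma> * g z + \<delta> \<noteq> 0" "h z = (\<alpha> * g z + \<beta>) / (\<gamma> * g z + \<delta>)" if "z \<in> ball 0 1 - K" for z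
    using h(1)[of z] fg[OF that] that by (auto simp: moebius_def split: if_splits)
  have "(\<lambda>z. (\<alpha> * g z + \<beta>) / (\<gamma> * g z + \<delta>)) holomorphic_on ball 0 1 - K"
    using hg(1) by (intro holomorphic_intros holg) auto
  then have hol: "h holomorphic_on ball 0 1 - K" by (rule holomorphic_transform) (use hg in auto)
  have lim: "(h \<longlongrightarrow> h z) (at z within ball 0 1)" if z: "z \<in> K" for z
  proof -
    have zb: "z \<in> ball 0 1" and zN: "f z = None" using z by (auto simp: K_def)
    have \<gamma>: "\<gamma> \<noteq> 0" and hz: "h z = \<alpha> / \<gamma>" using h(1)[OF zb] zN by (auto simp: moebius_def split: if_splits)
    have "is_pole g z" using mero zb zN by (simp add: sphere_meromorphic_on_def g_def)
    then have "filterlim (\<lambda>w. \<gamma> * g w) at_infinity (at z)"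
      unfolding is_pole_def by (intro tendsto_mult_filterlim_at_infinity[OF tendsto_const \<gamma>])
    then have "filterlim (\<lambda>w. \<gamma> * g w + \<delta>) at_infinity (at z)"
      by (rule tendsto_add_filterlim_at_infinity'[OF _ tendsto_const])
    then have "((\<lambda>w. (\<beta> - \<alpha> * \<delta> / \<gamma>) / (\<gamma> * g w + \<delta>)) \<longlongrightarrow> 0) (at z)"
      by (intro tendsto_divide_0[OF tendsto_const])
    \<comment> \<open>Splitting off \<open>\<alpha> / \<gamma>\<close> leaves a fraction whose denominator tends to infinity.\<close>
    then have "((\<lambda>w. \<alpha> / \<gamma> + (\<beta> - \<alpha> * \<delta> / \<gamma>) / (\<gamma> * g w + \<delta>)) \<longlongrightarrow> \<alpha> / \<gamma> + 0) (at z)"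
      by (intro tendsto_add tendsto_const)
    moreover have "\<forall>\<^sub>F w in at z. w \<in> (ball 0 1 - (K - {z})) - {z}"
      using finK zb by (intro eventually_at_in_open) (auto intro!: open_Diff finite_imp_closed)
    then have "\<forall>\<^sub>F w in at z. \<alpha> / \<gamma> + (\<beta> - \<alpha> * \<delta> / \<gamma>) / (\<gamma> * g w + \<delta>) = h w"
    proof eventually_elim
      case (elim w)
      then have "w \<in> ball 0 1 - K" by auto
      note hgw = hg[OF this]
      have "\<alpha> * g w + \<beta> = (\<alpha> / \<gamma>) * (\<gamma> * g w + \<delta>) + (\<beta> - \<alpha> * \<delta> / \<gamma>)"
        using \<gamma> by (simp add: field_simps)
      then show ?case unfolding hgw(2) using hgw(1) by (simp only: add_divide_distrib) simp
    qed
    ultimately have "(h \<longlongrightarrow> \<alpha> / \<gamma>) (at z)" using Lim_transform_eventually by fastforce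
    then show ?thesis unfolding hz by (rule Lim_at_imp_Lim_at_within)
  qed
  have holh: "h holomorphic_on ball 0 1"
    by (rule no_isolated_singularity'[OF lim hol open_ball finK])
  have "h ` ball 0 1 \<subseteq> ball 0 1" using h(2) by auto
  then show ?thesis using that[OF co holh injh] fh by blast
qed

section \<open>Hyperbolic and spherical discs\<close>

text \<open>
  The disc \<open>\<bar>w - a\<bar> < r \<bar>1 - cnj a w\<bar>\<close> of Schwarz and Pick is hyperbolic, the disc
  \<open>\<bar>w - p\<bar> < r \<bar>1 + cnj p w\<bar>\<close> is the image of \<open>\<bar>w\<bar> < r\<close> under a rotation of the sphere. The factor
  \<open>t\<close> in \<open>p = t a\<close> is chosen to make the coefficients of \<open>Re (cnj a w)\<close> in both inequalities
  agree. What remains has a definite sign for \<open>\<bar>t\<bar> < 1\<close>, \<open>0 \<le> r < 1\<close> and \<open>\<bar>w\<bar> \<le> 1\<close>: in the unit disc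
  the hyperbolic disc lies inside the spherical one, with room to spare if \<open>a \<noteq> 0\<close>.
\<close>

lemma spherical_disc_contains_hyperbolic_disc:
  fixes w a :: complex and r t :: real
  assumes t: "t * (1 + r\<^sup>2) = 1 - r\<^sup>2"
  shows "(cmod (w - t * a))\<^sup>2 - r\<^sup>2 * (cmod (1 + cnj (t * a) * w))\<^sup>2
     = ((cmod (w - a))\<^sup>2 - r\<^sup>2 * (cmod (1 - cnj a * w))\<^sup>2) - (cmod a)\<^sup>2 * (1 - t\<^sup>2) * (1 - r\<^sup>2 * (cmod w)\<^sup>2)"
proof -
  define X A Y where "X = (cmod w)\<^sup>2" and "A = (cmod a)\<^sup>2" and "Y = Re w * Re a + Im w * Im a"
  have 1: "(cmod (w - s * a))\<^sup>2 = X - 2 * s * Y + s\<^sup>2 * A" for s :: real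
    unfolding X_def A_def Y_def cmod_power2 by (simp add: power2_eq_square algebra_simps)
  have 2: "(cmod (1 + cnj (s * a) * w))\<^sup>2 = 1 + 2 * s * Y + s\<^sup>2 * A * X" for s :: real
    unfolding X_def A_def Y_def cmod_power2 by (simp add: power2_eq_square algebra_simps)
  have "X - 2 * t * Y + t\<^sup>2 * A - r\<^sup>2 * (1 + 2 * t * Y + t\<^sup>2 * A * X)
     = X + t\<^sup>2 * A - r\<^sup>2 - r\<^sup>2 * t\<^sup>2 * A * X - 2 * Y * (t * (1 + r\<^sup>2))" by (simp add: algebra_simps)
  also have "\<dots> = (X - 2 * Y + A) - r\<^sup>2 * (1 - 2 * Y + A * X) - A * (1 - t\<^sup>2) * (1 - r\<^sup>2 * X)"
    unfolding t by (simp add: algebra_simps)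
  finally show ?thesis
    using 1[of t] 2[of t] 1[of 1] 2[of "-1"] by (simp add: X_def A_def)
qed

text \<open>
  If \<open>h 0 = 0\<close>, this is the strict form of the
  Schwarz lemma, made uniform by compactness. Otherwise the Schwarz-Pick lemma confines the image to a
  hyperbolic disc about \<open>a = h 0\<close>. That disc lies, with a gap, inside the spherical disc of radius
  \<open>r\<close> about \<open>p\<close>, so a slightly smaller radius \<open>s\<close> still works.
\<close>

lemma schwarz_pick_spherical:
  assumes h: "h holomorphic_on ball 0 1" "h ` ball 0 1 \<subseteq> ball 0 1" and r: "0 < r" "r < 1"
    and nrot: "\<And>c. cmod c = 1 \<Longrightarrow> \<exists>z\<in>ball 0 1. h z \<noteq> c * z"
  obtains p s where "cmod p < 1" "0 \<le> s" "s < r"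
    "\<And>z. z \<in> ball 0 r \<Longrightarrow> cmod ((h z - p) / (1 + cnj p * h z)) < s"
proof -
  have h1: "cmod (h z) < 1" if "cmod z < 1" for z using h(2) that by (auto simp: image_subset_iff)
  define a where "a = h 0"
  have a1: "cmod a < 1" using h1[of 0] by (simp add: a_def)
  show ?thesis
  proof (cases "a = 0")
    case True
    have less: "cmod (h z) < cmod z" if "z \<noteq> 0" "cmod z < 1" for z
      using Schwarz_Lemma(1,3)[OF h(1) True[unfolded a_def] h1] that nrot
      by (metis order_le_less mem_ball_0)
    have "continuous_on (cball 0 r) (\<lambda>z. cmod (h z))"
      using h(1) r by (intro continuous_on_norm holomorphic_on_imp_continuous_on holomorphic_on_subset[OF h(1)]) auto
    then obtain \<zeta> where \<zeta>: "\<zeta> \<in> cball 0 r" "\<And>z. z \<in> cball 0 r \<Longrightarrow> cmod (h z) \<le> cmod (h \<zeta>)"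
      using continuous_attains_sup[of "cball 0 r" "\<lambda>z. cmod (h z)"] r by fastforce
    have "cmod (h \<zeta>) < r"
      using \<zeta>(1) less[of \<zeta>] r True by (cases "\<zeta> = 0") (auto simp: a_def)
    then obtain s where s: "cmod (h \<zeta>) < s" "s < r" using dense by blast
    show ?thesis
    proof (rule that[of 0 s])
      show "0 \<le> s" using s(1) norm_ge_zero[of "h \<zeta>"] by linarith
      show "cmod ((h z - 0) / (1 + cnj 0 * h z)) < s" if "z \<in> ball 0 r" for z
        using \<zeta>(2)[of z] that s by simp
    qed (use s in auto)
  next
    case False
    define t where "t = (1 - r\<^sup>2) / (1 + r\<^sup>2)"
    define A where "A = (cmod a)\<^sup>2"
    have r2: "0 < r\<^sup>2" "r\<^sup>2 < 1" using r by (auto simp: power_less_one_iff)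
    then have "1 + r\<^sup>2 \<noteq> 0" by linarith
    have t: "t * (1 + r\<^sup>2) = 1 - r\<^sup>2" "0 < t" "t < 1" using r2 \<open>1 + r\<^sup>2 \<noteq> 0\<close> by (auto simp: t_def add_pos_pos)
    have t2: "t\<^sup>2 < 1" using t by (auto simp: power_less_one_iff)
    have A: "0 < A" using False by (simp add: A_def)
    have denom: "1 - cnj a * h z \<noteq> 0" if "cmod z < 1" for z
    proof
      assume "1 - cnj a * h z = 0"
      then have "1 = cmod a * cmod (h z)" by (metis complex_mod_cnj eq_iff_diff_eq_0 norm_mult norm_one)
      then show False using a1 h1[OF that] mult_strict_mono[of "cmod a" 1 "cmod (h z)" 1] by simp
    qed
    define \<phi> where "\<phi> = (\<lambda>z. (h z - a) / (1 - cnj a * h z))"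
    have hol\<phi>: "\<phi> holomorphic_on ball 0 1"
      unfolding \<phi>_def using denom by (intro holomorphic_intros h(1)) auto
    have \<phi>1: "cmod (\<phi> z) < 1" if "cmod z < 1" for z
    proof -
      have "(cmod (1 - cnj a * h z))\<^sup>2 - (cmod (h z - a))\<^sup>2 = (1 - A) * (1 - (cmod (h z))\<^sup>2)"
        unfolding A_def cmod_power2 by (simp add: power2_eq_square algebra_simps)
      also have "\<dots> > 0" using a1 h1[OF that] by (simp add: A_def power_less_one_iff)
      finally have "cmod (h z - a) < cmod (1 - cnj a * h z)"
        using power2_less_imp_less[of "cmod (h z - a)" "cmod (1 - cnj a * h z)"] by simp
      then show ?thesis using denom[OF that] by (simp add: \<phi>_def norm_divide)
    qed
    have \<phi>le: "cmod (\<phi> z) \<le> cmod z" if "cmod z < 1" for z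
      using Schwarz_Lemma(1)[OF hol\<phi> _ \<phi>1 that] by (simp add: \<phi>_def a_def)
    \<comment> \<open>The gap in the previous identity, bounded below uniformly on the disc.\<close>
    define e where "e = A * (1 - t\<^sup>2) * (1 - r\<^sup>2)"
    have e: "0 < e" using A t2 r2 by (simp add: e_def)
    define p where "p = t * a"
    have p1: "cmod p < 1" using t a1 mult_strict_mono[of t 1 "cmod a" 1] by (simp add: p_def norm_mult)
    have key: "(cmod ((h z - p) / (1 + cnj p * h z)))\<^sup>2 < r\<^sup>2 - e / 4" if z: "z \<in> ball 0 r" for z
    proof -
      have z1: "cmod z < 1" using z r by simp
      define Q where "Q = (cmod (1 + cnj p * h z))\<^sup>2"
      have pw: "cmod (cnj p * h z) < 1"
        using p1 h1[OF z1] mult_strict_mono[of "cmod p" 1 "cmod (h z)" 1] by (simp add: norm_mult)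
      then have "1 + cnj p * h z \<noteq> 0" by (metis add_eq_0_iff norm_minus_cancel norm_one less_irrefl)
      then have Q0: "0 < Q" by (simp add: Q_def)
      have "cmod (1 + cnj p * h z) \<le> 2" using pw norm_triangle_ineq[of 1 "cnj p * h z"] by simp
      then have Q4: "Q \<le> 4" unfolding Q_def using power_mono[of _ "2::real" 2] by fastforce
      have "cmod (\<phi> z) < r" using \<phi>le[OF z1] z by simp
      then have "cmod (h z - a) < r * cmod (1 - cnj a * h z)"
        using denom[OF z1] by (simp add: \<phi>_def norm_divide divide_less_eq)
      then have "(cmod (h z - a))\<^sup>2 < r\<^sup>2 * (cmod (1 - cnj a * h z))\<^sup>2"
        by (metis norm_ge_zero power_mult_distrib power_strict_mono zero_less_numeral)
      moreover have "e \<le> A * (1 - t\<^sup>2) * (1 - r\<^sup>2 * (cmod (h z))\<^sup>2)"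
        unfolding e_def using A t2 h1[OF z1] r2
        by (intro mult_left_mono) (auto simp: mult_left_le power_le_one_iff)
      ultimately have "(cmod (h z - p))\<^sup>2 - r\<^sup>2 * Q < - e"
        using spherical_disc_contains_hyperbolic_disc[OF t(1), of "h z" a] by (simp add: Q_def p_def A_def)
      then have "(cmod (h z - p))\<^sup>2 < r\<^sup>2 * Q - e" by simp
      \<comment> \<open>\<open>Q \<le> 4\<close>, because \<open>p\<close> and \<open>h z\<close> lie in the unit disc.\<close>
      also have "\<dots> \<le> (r\<^sup>2 - e / 4) * Q" using Q4 e by (simp add: algebra_simps)
      finally show ?thesis using Q0 by (simp add: norm_divide power_divide Q_def divide_less_eq)
    qed
    have pos: "0 < r\<^sup>2 - e / 4" using key[of 0] r by (smt (verit) centre_in_ball zero_le_power2)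
    show ?thesis
    proof (rule that[of p "sqrt (r\<^sup>2 - e / 4)"])
      show "sqrt (r\<^sup>2 - e / 4) < r" using e r by (intro real_less_lsqrt) auto
      show "cmod ((h z - p) / (1 + cnj p * h z)) < sqrt (r\<^sup>2 - e / 4)" if "z \<in> ball 0 r" for z
        using key[OF that] by (rule real_less_rsqrt)
    qed (use p1 pos in auto)
  qed
qed

section \<open>The area inequality\<close>

text \<open>
  Rotate the image into the unit disc, and then rotate the spherical disc found by
  Schwarz and Pick to a disc of radius \<open>s < r\<close> about the origin. Neither rotation changes the
  area. The function \<open>h z = c z\<close>, for which no such \<open>s\<close> exists, belongs to an isometry \<open>f\<close>.
\<close>

lemma image_area_less_disc_area:
  assumes f: "spherically_convex_map f" and ni: "\<not> spherical_isometry f" and r: "0 < r" "r < 1"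
  shows "image_area f r < disc_area r"
proof -
  obtain \<alpha> \<beta> \<gamma> \<delta> h where 
    co: "rotation_coeffs \<alpha> \<beta> \<gamma> \<delta>"
    and h: "h holomorphic_on ball 0 1" "inj_on h (ball 0 1)" "h ` ball 0 1 \<subseteq> ball 0 1"
    and fh: "\<And>z. z \<in> ball 0 1 \<Longrightarrow> f z = moebius \<delta> (-\<beta>) (-\<gamma>) \<alpha> (Some (h z))"
    using spherically_convex_map_rotate_into_disc[OF f] by blast
  have nrot: "\<exists>z\<in>ball 0 1. h z \<noteq> c * z" if c: "cmod c = 1" for c
  proof (rule ccontr)
    assume "\<not> ?thesis"
    then have hc: "f z = moebius \<delta> (-\<beta>) (-\<gamma>) \<alpha> (Some (c * z))" if "z \<in> ball 0 1" for z
      using fh that by auto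
    have cis: "c = cis (Arg c)" using c by (metis cis_Arg norm_zero sgn_div_norm div_by_1 inverse_1 scaleR_one zero_neq_one)
    have cc: "c * cnj c = 1" using c by (simp add: complex_norm_square[symmetric])
    have c0: "c \<noteq> 0" using c by auto
    have "\<exists>\<rho>\<in>Rot. \<forall>z. moebius \<delta> (-\<beta>) (-\<gamma>) \<alpha> (Some (c * z)) = \<rho> (Some z)"
      using co unfolding rotation_coeffs_def
    proof (elim disjE exE conjE)
      fix a assume e: "\<alpha> = 1" "\<beta> = - a" "\<gamma> = cnj a" "\<delta> = 1"
      \<comment> \<open>Solving \<open>(w - a) / (1 + cnj a w) = c z\<close> for \<open>w\<close> gives the rotation with parameter \<open>- cnj c * a\<close>.\<close>
      have "moebius (cis (Arg c)) (- (cis (Arg c) * (- cnj c * a))) (cnj (- cnj c * a)) 1 \<in> Rot"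
        unfolding Rot_def by blast
      then have "moebius c a (- (c * cnj a)) 1 \<in> Rot"
        using cc by (simp flip: cis mult.assoc)
      then show ?thesis 
        by (intro bexI[where x = "moebius c a (- (c * cnj a)) 1"]) (auto simp: moebius_def e algebra_simps)
    next
      assume e: "\<alpha> = 0" "\<beta> = 1" "\<gamma> = 1" "\<delta> = 0"
      have "moebius 0 (cis (- Arg c)) 1 0 \<in> Rot" unfolding Rot_def by blast
      then have "moebius 0 (inverse c) 1 0 \<in> Rot" by (metis cis cis_inverse)
      then show ?thesis
        using c0 by (intro bexI[where x = "moebius 0 (inverse c) 1 0"]) (auto simp: moebius_def e field_simps)
    qed
    then have "spherical_isometry f" unfolding spherical_isometry_def using hc by metis
    then show False using ni by blast
  qed
  obtain p s where p: "cmod p < 1" and s: "0 \<le> s" "s < r"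
    and ks: "\<And>z. z \<in> ball 0 r \<Longrightarrow> cmod ((h z - p) / (1 + cnj p * h z)) < s"
    using schwarz_pick_spherical[OF h(1,3) r nrot] by blast
  define k where "k = (\<lambda>z. (h z - p) / (1 + cnj p * h z))"
  have denom: "1 + cnj p * h z \<noteq> 0" if "cmod z < 1" for z
  proof
    assume "1 + cnj p * h z = 0"
    then have "1 = cmod p * cmod (h z)" by (metis add_eq_0_iff complex_mod_cnj norm_minus_cancel norm_mult norm_one)
    moreover have "cmod (h z) < 1" using h(3) that by (auto simp: image_subset_iff)
    ultimately show False using p mult_strict_mono[of "cmod p" 1 "cmod (h z)" 1] by simp
  qed
  have up: "unitary_coeffs 1 (- p) (cnj p) 1" by (intro rotation_coeffs_imp_unitary_coeffs) (simp add: rotation_coeffs_def)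
  have holk: "k holomorphic_on ball 0 r"
    unfolding k_def using denom r by (intro holomorphic_intros holomorphic_on_subset[OF h(1)]) auto
  have injk: "inj_on k (ball 0 r)"
  proof (rule inj_onI)
    fix z w assume zw: "z \<in> ball 0 r" "w \<in> ball 0 r" "k z = k w"
    have "moebius 1 (- p) (cnj p) 1 (Some (h v)) = Some (k v)" if "v \<in> ball 0 r" for v
      using denom[of v] that r by (simp add: moebius_def k_def add.commute)
    then have "Some (h z) = Some (h w)"
      using zw moebius_inverse[OF unitary_coeffs_det_nz[OF up]] by metis
    then show "z = w" using h(2) zw r by (auto simp: inj_on_def)
  qed
  have "image_area f r = (\<integral>\<^sup>+z\<in>ball 0 r. ennreal ((cmod (deriv h z) / (1 + (cmod (h z))\<^sup>2))\<^sup>2) \<partial>lborel)"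
    using unitary_coeffs_inverse[OF rotation_coeffs_imp_unitary_coeffs[OF co]] r h fh
    by (intro image_area_moebius) auto
  also have "\<dots> = (\<integral>\<^sup>+z\<in>ball 0 r. ennreal ((cmod (deriv k z) / (1 + (cmod (k z))\<^sup>2))\<^sup>2) \<partial>lborel)"
  proof (intro nn_integral_cong)
    fix z
    have "cmod (deriv k z) / (1 + (cmod (k z))\<^sup>2) = cmod (deriv h z) / (1 + (cmod (h z))\<^sup>2)" if "z \<in> ball 0 r"
      using denom r that
      by (intro unitary_coeffs_spherical_deriv[OF up open_ball that holomorphic_on_subset[OF h(1)]])
        (auto simp: k_def add.commute)
    then show "ennreal ((cmod (deriv h z) / (1 + (cmod (h z))\<^sup>2))\<^sup>2) * indicator (ball 0 r) z
       = ennreal ((cmod (deriv k z) / (1 + (cmod (k z))\<^sup>2))\<^sup>2) * indicator (ball 0 r) z"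
      by (cases "z \<in> ball 0 r") auto
  qed
  also have "\<dots> \<le> disc_area s"
    using ks by (intro area_image_le_disc_area holk injk) (auto simp: k_def)
  also have "\<dots> < disc_area r" by (rule disc_area_strict_mono[OF s])
  finally show ?thesis .
qed

theorem theorem1p1:
  fixes f :: "complex \<Rightarrow> riemann_sphere"
  assumes "spherically_convex_map f"
  shows "(\<forall>r. 0 < r \<and> r < 1 \<longrightarrow> image_area f r \<le> disc_area r) \<and>
         ((\<exists>r. 0 < r \<and> r < 1 \<and> image_area f r = disc_area r) \<longleftrightarrow> spherical_isometry f)"
proof (cases "spherical_isometry f")
  case True
  then have "image_area f r = disc_area r" if "r < 1" for r
    using image_area_spherical_isometry that by simp
  then show ?thesis using True by (auto intro!: exI[of _ "1/2"])
next
  case False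
  then have "image_area f r < disc_area r" if "0 < r" "r < 1" for r
    using image_area_less_disc_area assms that by blast
  then show ?thesis using False by (metis order_less_imp_le less_irrefl)
qed

end
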